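(* For any convex function $\Phi$ as in the context and any $n\ge0$, $$D_\Phi(\pi_{2(n+1)},\nu_V)\le\chi(S)\,D_\Phi(\lambda_U,\pi_{2n+1})\le\chi(S)^2D_\Phi(\pi_{2n},\nu_V),$$ $$D_\Phi(\nu_V,\pi_{2(n+1)})\le\chi(S)\,D_\Phi(\pi_{2n+1},\lambda_U)\le\chi(S)^2D_\Phi(\nu_V,\pi_{2n}).$$ These inequalities remain valid when $(\nu_V,\pi_{2n})$ is replaced by $(\lambda_U,\pi_{2n+1})$, that is, $$D_\Phi(\lambda_U,\pi_{2n+3})\le\chi(S)\,D_\Phi(\pi_{2(n+1)},\nu_V)\le\chi(S)^2D_\Phi(\lambda_U,\pi_{2n+1}),$$ $$D_\Phi(\pi_{2n+3},\lambda_U)\le\chi(S)\,D_\Phi(\nu_V,\pi_{2(n+1)})\le\chi(S)^2D_\Phi(\pi_{2n+1},\lambda_U).$$ If in addition $\jmath(Q)>0$, then $\chi(S)<1$ and there exists some $c>0$ such that for any $n\ge0$ $$\Big\|\log\frac{d\pi_{2n}}{d\nu_V}\Big\|\vee\Big\|\log\frac{d\pi_{2n+1}}{d\lambda_U}\Big\|\le c\,\chi(S)^{2n}.$$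
   Context: Setting. $(\mathbb X,\lambda)$ and $(\mathbb Y,\nu)$ are locally compact Polish spaces with locally bounded positive measures $\lambda,\nu$. $U:\mathbb X\to\mathbb R$, $V:\mathbb Y\to\mathbb R$, $W:\mathbb X\times\mathbb Y\to\mathbb R$ are measurable, such that $\lambda_U(dx):=e^{-U(x)}\lambda(dx)$ and $\nu_V(dy):=e^{-V(y)}\nu(dy)$ are probability measures and $Q(x,dy):=e^{-W(x,y)}\nu(dy)$ is a Markov kernel. Put $R(y,dx):=e^{-W(x,y)}\lambda(dx)$. For a kernel $K$, $K(f)(x)=\int K(x,dy)f(y)$ and $(\mu K)(dy)=\int\mu(dx)K(x,dy)$. It is a standing assumption that some probability measure with marginals $\lambda_U,\nu_V$ has finite relative entropy with respect to $\lambda_U(dx)Q(x,dy)$. Sinkhorn iterations. $U_0=U$, $V_0=0$, and for $n\ge0$: $U_{2n+1}=U_{2n}=U+\log Q(e^{-V_{2n}})$, $V_{2(n+1)}=V_{2n+1}=V+\log R(e^{-U_{2n}})$; $$S_{2n}(x,dy)=\frac{Q(x,dy)e^{-V_{2n}(y)}}{Q(e^{-V_{2n}})(x)},\qquad S_{2n+1}(y,dx)=\frac{R(y,dx)e^{-U_{2n+1}(x)}}{R(e^{-U_{2n+1}})(y)};$$ $\pi_{2n}=\lambda_US_{2n}$ and $\pi_{2n+1}=\nu_VS_{2n+1}$. Coefficients. The Dobrushin coefficient of a Markov kernel $K$ is $\chi(K)=\sup_{x_1,x_2}\|\delta_{x_1}K-\delta_{x_2}K\|_{tv}$, where $\|\mu_1-\mu_2\|_{tv}=\tfrac12|\mu_1-\mu_2|(1)$;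 $\chi(S):=\sup_{n\ge0}\chi(S_n)$. Also $\jmath(Q)=\inf_{x_1,x_2\in\mathbb X}\inf_{y\in\mathbb Y}\frac{d\delta_{x_1}Q}{d\delta_{x_2}Q}(y)$ with $\frac{d\delta_{x_1}Q}{d\delta_{x_2}Q}(y)=e^{W(x_2,y)-W(x_1,y)}$. $\Phi$-entropy. $\Phi:\mathbb R_+^2\to\mathbb R\cup\{+\infty\}$ is convex with $\Phi(au,av)=a\Phi(u,v)$ for all $a\in\mathbb R_+$ and $\Phi(1,1)=0$; $D_\Phi(\mu_1,\mu_2)=\int\Phi\big(\tfrac{d\mu_1}{d\gamma},\tfrac{d\mu_2}{d\gamma}\big)d\gamma$ for any dominating measure $\gamma$ (independent of $\gamma$). $\|f\|=\sup|f|$.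
   Formalization: The final bound on the log-density of π_{2n} at n=0 is claimed only when ‖log dπ_0/dν_V‖ is finite (it can be infinite even if j(Q)>0, e.g. W(x,y)=w(y)); for n≥1, and for π_{2n+1} with all n≥0, the bound is as stated. *)

theory Defs
  imports "HOL-Probability.Probability" "HOL-Library.Disjoint_Sets"
begin

section \<open>Divergences and coefficients\<close>

definition locally_bounded_measure :: "'a::topological_space measure \<Rightarrow> bool" where
  "locally_bounded_measure M \<longleftrightarrow> (\<forall>x. \<exists>A. open A \<and> x \<in> A \<and> emeasure M A < \<infinity>)"

text \<open>The total variation norm \<open>|\<mu>\<^sub>1 - \<mu>\<^sub>2|(1) / 2\<close> of the difference of two finite
  measures on the same space; the mass of the variation of a signed measure is the supremum over
  finite measurable partitions.\<close>

definition tv_dist :: "'a measure \<Rightarrow> 'a measure \<Rightarrow> real" where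
  "tv_dist M N =
     (1/2) * (SUP P \<in> {P. finite P \<and> partition_on (space M) P \<and> P \<subseteq> sets M}.
       \<Sum>A\<in>P. \<bar>measure M A - measure N A\<bar>)"

definition dobrushin :: "('a \<Rightarrow> 'b measure) \<Rightarrow> real" where
  "dobrushin K = (SUP (x1, x2) \<in> UNIV. tv_dist (K x1) (K x2))"

text \<open>The value \<open>-\<infinity>\<close> is excluded, and \<open>\<Phi>\<close> is only relevant on the closed positive quadrant.
  In \<^typ>\<open>ereal\<close>, \<open>0 * \<infinity> = 0\<close>; the case \<open>a = 0\<close> of homogeneity says \<open>\<Phi> 0 0 = 0\<close>.\<close>

definition entropy_function :: "(real \<Rightarrow> real \<Rightarrow> ereal) \<Rightarrow> bool" where
  "entropy_function \<Phi> \<longleftrightarrow>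
     (\<forall>u\<ge>0. \<forall>v\<ge>0. \<Phi> u v \<noteq> -\<infinity>) \<and>
     (\<forall>u\<ge>0. \<forall>v\<ge>0. \<forall>u'\<ge>0. \<forall>v'\<ge>0. \<forall>t\<in>{0..1}.
        \<Phi> ((1 - t) * u + t * u') ((1 - t) * v + t * v')
          \<le> ereal (1 - t) * \<Phi> u v + ereal t * \<Phi> u' v') \<and>
     (\<forall>a\<ge>0. \<forall>u\<ge>0. \<forall>v\<ge>0. \<Phi> (a * u) (a * v) = ereal a * \<Phi> u v) \<and>
     \<Phi> 1 1 = 0"

definition ereal_integral :: "'a measure \<Rightarrow> ('a \<Rightarrow> ereal) \<Rightarrow> ereal" where
  "ereal_integral M f =
     enn2ereal (\<integral>\<^sup>+ x. e2ennreal (f x) \<partial>M) - enn2ereal (\<integral>\<^sup>+ x. e2ennreal (- f x) \<partial>M)"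

definition measure_plus :: "'a measure \<Rightarrow> 'a measure \<Rightarrow> 'a measure" where
  "measure_plus M N = measure_of (space M) (sets M) (\<lambda>A. emeasure M A + emeasure N A)"

text \<open>By homogeneity the integral does not depend on the dominating measure; we take
  \<open>\<gamma> = \<mu>\<^sub>1 + \<mu>\<^sub>2\<close>. For finite measures the negative part is always integrable, since a convex
  homogeneous \<open>\<Phi>\<close> as above is bounded below by a linear function on the quadrant.\<close>

definition Phi_div :: "(real \<Rightarrow> real \<Rightarrow> ereal) \<Rightarrow> 'a measure \<Rightarrow> 'a measure \<Rightarrow> ereal" where
  "Phi_div \<Phi> M N =
     (let \<gamma> = measure_plus M N in
      ereal_integral \<gamma> (\<lambda>x. \<Phi> (enn2real (RN_deriv \<gamma> M x)) (enn2real (RN_deriv \<gamma> N x))))"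

text \<open>Finiteness of the relative entropy of \<open>P\<close> with respect to \<open>R\<close>. The negative part of
  \<open>log (dP/dR)\<close> is always \<open>P\<close>-integrable, so the entropy is finite iff \<open>P\<close> is absolutely
  continuous with respect to \<open>R\<close> and \<open>log (dP/dR)\<close> is \<open>P\<close>-integrable.\<close>

definition finite_rel_entropy :: "'a measure \<Rightarrow> 'a measure \<Rightarrow> bool" where
  "finite_rel_entropy P R \<longleftrightarrow>
     absolutely_continuous R P \<and> integrable P (entropy_density (exp 1) R P)"

text \<open>The uniform norm of \<open>log (dN/dM)\<close>. A Radon-Nikodym derivative is determined only up to
  \<open>M\<close>-null sets, so the supremum is that of the best version (the infimum is attained and is the
  essential supremum). Versions taking the value \<open>0\<close> or \<open>\<infinity>\<close> somewhere have infinite norm and are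
  left out, so that the real logarithm can be used; the infimum over the empty set is \<open>\<infinity>\<close>.\<close>

definition log_density_norm :: "'a measure \<Rightarrow> 'a measure \<Rightarrow> ereal" where
  "log_density_norm M N =
     (INF f \<in> {f \<in> borel_measurable M. (\<forall>x\<in>space M. f x > 0) \<and>
                 density M (\<lambda>x. ennreal (f x)) = N}.
        SUP x \<in> space M. ereal \<bar>ln (f x)\<bar>)"


section \<open>Sinkhorn iterations\<close>

definition gibbs :: "'a measure \<Rightarrow> ('a \<Rightarrow> real) \<Rightarrow> 'a measure" where
  "gibbs M f = density M (\<lambda>x. ennreal (exp (- f x)))"

abbreviation kerQ :: "'b measure \<Rightarrow> ('a \<Rightarrow> 'b \<Rightarrow> real) \<Rightarrow> 'a \<Rightarrow> 'b measure" where
  "kerQ nu W x \<equiv> gibbs nu (\<lambda>y. W x y)"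

abbreviation kerR :: "'a measure \<Rightarrow> ('a \<Rightarrow> 'b \<Rightarrow> real) \<Rightarrow> 'b \<Rightarrow> 'a measure" where
  "kerR lam W y \<equiv> gibbs lam (\<lambda>x. W x y)"

definition jQ :: "('a \<Rightarrow> 'b \<Rightarrow> real) \<Rightarrow> real" where
  "jQ W = (INF (x1, x2, y) \<in> UNIV. exp (W x2 y - W x1 y))"

text \<open>Since \<open>U\<^sub>2\<^sub>n\<^sub>+\<^sub>1 = U\<^sub>2\<^sub>n\<close> and \<open>V\<^sub>2\<^sub>n\<^sub>+\<^sub>2 = V\<^sub>2\<^sub>n\<^sub>+\<^sub>1\<close>, only even indices are needed:
  \<open>sinkU n\<close> is \<open>U\<^sub>2\<^sub>n = U\<^sub>2\<^sub>n\<^sub>+\<^sub>1 = U + log Q(exp(-V\<^sub>2\<^sub>n))\<close> and \<open>sinkV n\<close> is \<open>V\<^sub>2\<^sub>n\<close>. As \<open>Q(1) = 1\<close> and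
  \<open>V\<^sub>0 = 0\<close>, \<open>U\<^sub>0 = U\<close>. The integrals are positive and almost everywhere finite; on the exceptional
  null set where one of them is infinite, its logarithm is read as \<open>0\<close>, and the corresponding
  kernel below is the zero measure.\<close>

definition stepU ::
  "'b measure \<Rightarrow> ('a \<Rightarrow> real) \<Rightarrow> ('a \<Rightarrow> 'b \<Rightarrow> real) \<Rightarrow> ('b \<Rightarrow> real) \<Rightarrow> 'a \<Rightarrow> real" where
  "stepU nu U W v x = U x + ln (enn2real (\<integral>\<^sup>+ y. ennreal (exp (- v y)) \<partial>kerQ nu W x))"

definition stepV ::
  "'a measure \<Rightarrow> ('b \<Rightarrow> real) \<Rightarrow> ('a \<Rightarrow> 'b \<Rightarrow> real) \<Rightarrow> ('a \<Rightarrow> real) \<Rightarrow> 'b \<Rightarrow> real" where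
  "stepV lam V W u y = V y + ln (enn2real (\<integral>\<^sup>+ x. ennreal (exp (- u x)) \<partial>kerR lam W y))"

primrec sinkV ::
  "'a measure \<Rightarrow> 'b measure \<Rightarrow> ('a \<Rightarrow> real) \<Rightarrow> ('b \<Rightarrow> real) \<Rightarrow> ('a \<Rightarrow> 'b \<Rightarrow> real) \<Rightarrow> nat \<Rightarrow> 'b \<Rightarrow> real"
where
  "sinkV lam nu U V W 0 = (\<lambda>y. 0)"
| "sinkV lam nu U V W (Suc n) = stepV lam V W (stepU nu U W (sinkV lam nu U V W n))"

definition sinkU ::
  "'a measure \<Rightarrow> 'b measure \<Rightarrow> ('a \<Rightarrow> real) \<Rightarrow> ('b \<Rightarrow> real) \<Rightarrow> ('a \<Rightarrow> 'b \<Rightarrow> real) \<Rightarrow> nat \<Rightarrow> 'a \<Rightarrow> real"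
where
  "sinkU lam nu U V W n = stepU nu U W (sinkV lam nu U V W n)"

text \<open>\<open>sinkS_even n\<close> is \<open>S\<^sub>2\<^sub>n\<close>, \<open>sinkS_odd n\<close> is \<open>S\<^sub>2\<^sub>n\<^sub>+\<^sub>1\<close>, and likewise for \<open>\<pi>\<close>.\<close>

definition sinkS_even ::
  "'a measure \<Rightarrow> 'b measure \<Rightarrow> ('a \<Rightarrow> real) \<Rightarrow> ('b \<Rightarrow> real) \<Rightarrow> ('a \<Rightarrow> 'b \<Rightarrow> real) \<Rightarrow> nat
     \<Rightarrow> 'a \<Rightarrow> 'b measure" where
  "sinkS_even lam nu U V W n x =
     density (kerQ nu W x)
       (\<lambda>y. ennreal (exp (- sinkV lam nu U V W n y)) /
            (\<integral>\<^sup>+ z. ennreal (exp (- sinkV lam nu U V W n z)) \<partial>kerQ nu W x))"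

definition sinkS_odd ::
  "'a measure \<Rightarrow> 'b measure \<Rightarrow> ('a \<Rightarrow> real) \<Rightarrow> ('b \<Rightarrow> real) \<Rightarrow> ('a \<Rightarrow> 'b \<Rightarrow> real) \<Rightarrow> nat
     \<Rightarrow> 'b \<Rightarrow> 'a measure" where
  "sinkS_odd lam nu U V W n y =
     density (kerR lam W y)
       (\<lambda>x. ennreal (exp (- sinkU lam nu U V W n x)) /
            (\<integral>\<^sup>+ z. ennreal (exp (- sinkU lam nu U V W n z)) \<partial>kerR lam W y))"

definition sinkpi_even ::
  "'a measure \<Rightarrow> 'b measure \<Rightarrow> ('a \<Rightarrow> real) \<Rightarrow> ('b \<Rightarrow> real) \<Rightarrow> ('a \<Rightarrow> 'b \<Rightarrow> real) \<Rightarrow> nat \<Rightarrow> 'b measure"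
where
  "sinkpi_even lam nu U V W n = gibbs lam U \<bind> sinkS_even lam nu U V W n"

definition sinkpi_odd ::
  "'a measure \<Rightarrow> 'b measure \<Rightarrow> ('a \<Rightarrow> real) \<Rightarrow> ('b \<Rightarrow> real) \<Rightarrow> ('a \<Rightarrow> 'b \<Rightarrow> real) \<Rightarrow> nat \<Rightarrow> 'a measure"
where
  "sinkpi_odd lam nu U V W n = gibbs nu V \<bind> sinkS_odd lam nu U V W n"

definition chiS ::
  "'a measure \<Rightarrow> 'b measure \<Rightarrow> ('a \<Rightarrow> real) \<Rightarrow> ('b \<Rightarrow> real) \<Rightarrow> ('a \<Rightarrow> 'b \<Rightarrow> real) \<Rightarrow> real" where
  "chiS lam nu U V W =
     max (SUP n. dobrushin (sinkS_even lam nu U V W n))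
         (SUP n. dobrushin (sinkS_odd lam nu U V W n))"

end

theory Submission
  imports Defs
begin

text \<open>Why the divergences contract. Let \<open>\<lambda>\<^sub>U\<close> and \<open>\<nu>\<^sub>V\<close> be the prescribed marginals. The potentials are
chosen so that every Sinkhorn kernel maps the marginal of the preceding iterate to a
prescribed one: \<open>\<pi>\<^sub>2\<^sub>n\<^sub>+\<^sub>1 S\<^sub>2\<^sub>n\<^sub>+\<^sub>2 = \<nu>\<^sub>V\<close>, while \<open>\<lambda>\<^sub>U S\<^sub>2\<^sub>n\<^sub>+\<^sub>2 = \<pi>\<^sub>2\<^sub>n\<^sub>+\<^sub>2\<close> by definition, and the same with
the spaces exchanged. One half-step therefore applies a single Markov kernel to both
arguments of the divergence, and each inequality is the contraction of \<open>\<Phi>\<close>-divergences by a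
Markov kernel with its Dobrushin coefficient as factor. The even and the odd half-steps are the
same statement (locale \<open>sinkhorn_step\<close>) with the two spaces exchanged and \<open>W\<close> transposed.

Why kernels contract (\<open>nonneg_entropy_kernel_contraction\<close>). Let \<open>p1\<close>, \<open>p2\<close> be densities and \<open>k\<close> the
density of the kernel. Pair the points with \<open>p2 < p1\<close> with those with \<open>p1 < p2\<close>, in proportion to
the excess mass, and remove from both kernels of such a pair their common part, which has mass at
least \<open>1 - \<delta>\<close>. The removed part contributes equally to the two images, so subadditivity and
\<open>\<Phi>(c, c) = 0\<close> discard it. What remains is a kernel of mass at most \<open>\<delta>\<close>, to which Jensen's
inequality for the homogeneous function \<open>\<Phi>\<close> applies. The argument covers
functions that jump or are infinite at the boundary of the quadrant.

Integrals of functions of both signs are avoided. If \<open>c * (u - v) \<le> \<Phi> u v\<close> for some \<open>c\<close>,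
subtracting this linear function makes \<open>\<Phi>\<close> nonnegative and changes no divergence of probability
measures. Otherwise convexity forces \<open>\<Phi>\<close> to be infinite on one side of the diagonal, and the
divergence takes only the values \<open>0\<close> and \<open>\<infinity>\<close>.

Why the logarithms converge uniformly. If \<open>j(Q) > 0\<close> then the cross ratios of \<open>exp (- W)\<close> are at
least \<open>\<kappa> = j(Q)\<^sup>2\<close>. In contrast to positivity of \<open>j(Q)\<close>, this condition is symmetric in the two
spaces and unaffected by potentials and normalisations, so all Sinkhorn kernels satisfy
\<open>\<kappa> * k(z, y) \<le> k(x, y)\<close>. Hence \<open>\<chi>(S) \<le> 1 - \<kappa>\<close>. Integrating the same inequality bounds \<open>k(x, y)\<close> by
\<open>1 / \<kappa>\<close> times the density of the prescribed marginal, so the relative density of the next iterate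
is at least \<open>\<kappa>\<close> and differs from \<open>1\<close> by at most \<open>1 / \<kappa>\<close> times an \<open>L\<^sup>1\<close>-distance of the preceding
marginals. That distance is a \<open>\<Phi>\<close>-divergence, with \<open>\<Phi>(u, v) = \<bar>u - v\<bar>\<close>, so it decays like
\<open>\<chi>(S)\<^sup>2\<^sup>n\<close> by the first part.\<close>

section \<open>Sublinear functions on the quadrant\<close>

text \<open>In the presence of homogeneity, convexity is subadditivity; this form is the convenient one for
splitting arguments into sums.\<close>

definition sublinear :: "(real \<Rightarrow> real \<Rightarrow> ereal) \<Rightarrow> bool" where
  "sublinear F \<longleftrightarrow>
     (\<forall>u\<ge>0. \<forall>v\<ge>0. F u v \<noteq> -\<infinity>) \<and>
     (\<forall>u\<ge>0. \<forall>v\<ge>0. \<forall>u'\<ge>0. \<forall>v'\<ge>0. F (u + u') (v + v') \<le> F u v + F u' v') \<and>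
     (\<forall>a\<ge>0. \<forall>u\<ge>0. \<forall>v\<ge>0. F (a * u) (a * v) = ereal a * F u v)"

lemma sublinear_add:
  "sublinear F \<Longrightarrow> 0 \<le> u \<Longrightarrow> 0 \<le> v \<Longrightarrow> 0 \<le> u' \<Longrightarrow> 0 \<le> v' \<Longrightarrow> F (u + u') (v + v') \<le> F u v + F u' v'"
  unfolding sublinear_def by blast

lemma sublinear_scale:
  "sublinear F \<Longrightarrow> 0 \<le> a \<Longrightarrow> 0 \<le> u \<Longrightarrow> 0 \<le> v \<Longrightarrow> F (a * u) (a * v) = ereal a * F u v"
  unfolding sublinear_def by blast

lemma sublinear_conic_combination:
  assumes F: "sublinear F" and "0 \<le> a" "0 \<le> b" "0 \<le> u" "0 \<le> v" "0 \<le> u'" "0 \<le> v'"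
  shows "F (a * u + b * u') (a * v + b * v') \<le> ereal a * F u v + ereal b * F u' v'"
proof -
  have "F (a * u + b * u') (a * v + b * v') \<le> F (a * u) (a * v) + F (b * u') (b * v')"
    using assms by (intro sublinear_add) auto
  also have "\<dots> = ereal a * F u v + ereal b * F u' v'"
    using assms by (simp add: sublinear_scale[OF F])
  finally show ?thesis .
qed

text \<open>Normalise by a linear function so that \<open>F\<close> vanishes on the ray through \<open>(A1, A2)\<close>. A positive
combination of a point on either side of that ray lies on it, so by subadditivity every quotient
\<open>F / D\<close> (with \<open>D\<close> proportional to the signed distance from the ray) on the positive side is at least every quotient
on the negative side; the slope of the supporting functional is a number in between. The two given
points make both families of quotients nonempty, so that this number is real.\<close>

lemma sublinear_support:
  fixes F :: "real \<Rightarrow> real \<Rightarrow> ereal"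
  assumes F: "sublinear F"
    and A: "0 \<le> A1" "0 \<le> A2" "0 < A1 + A2" "F A1 A2 = ereal r"
    and z1: "0 \<le> s1" "0 \<le> t1" "s1 * A2 > t1 * A1" "F s1 t1 \<noteq> \<infinity>"
    and z2: "0 \<le> s2" "0 \<le> t2" "s2 * A2 < t2 * A1" "F s2 t2 \<noteq> \<infinity>"
  obtains \<alpha> \<beta> where "\<And>u v. 0 \<le> u \<Longrightarrow> 0 \<le> v \<Longrightarrow> ereal (\<alpha> * u + \<beta> * v) \<le> F u v"
    and "\<alpha> * A1 + \<beta> * A2 = r"
proof -
  define D where "D u v = u * A2 - v * A1" for u v
  define L where "L u v = r / (A1 + A2) * (u + v)" for u v
  define f where "f u v = real_of_ereal (F u v)" for u v
  have f: "F u v = ereal (f u v)" if "0 \<le> u" "0 \<le> v" "F u v \<noteq> \<infinity>" for u v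
    using that F unfolding f_def sublinear_def by (cases "F u v") auto
  have slope: "(f s t - L s t) / D s t \<ge> (f s' t' - L s' t') / D s' t'"
    if "0 \<le> s" "0 \<le> t" "D s t > 0" "F s t \<noteq> \<infinity>" "0 \<le> s'" "0 \<le> t'" "D s' t' < 0" "F s' t' \<noteq> \<infinity>"
    for s t s' t'
  proof -
    define k where "k = s * t' - s' * t"
    have e1: "(- D s' t') * s + D s t * s' = k * A1"
      by (simp add: D_def k_def algebra_simps)
    have e2: "(- D s' t') * t + D s t * t' = k * A2"
      by (simp add: D_def k_def algebra_simps)
    have p1: "0 \<le> k * A1"
      unfolding e1[symmetric] using that by (intro add_nonneg_nonneg mult_nonneg_nonneg) auto
    have p2: "0 \<le> k * A2"
      unfolding e2[symmetric] using that by (intro add_nonneg_nonneg mult_nonneg_nonneg) auto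
    have "0 \<le> k * (A1 + A2)"
      using p1 p2 by (simp add: algebra_simps)
    then have k: "0 \<le> k"
      using A(3) by (simp add: zero_le_mult_iff)
    have "F (k * A1) (k * A2) = ereal (k * r)"
      using k A by (simp add: sublinear_scale[OF F])
    moreover have "F (k * A1) (k * A2) \<le> ereal (- D s' t') * F s t + ereal (D s t) * F s' t'"
      unfolding e1[symmetric] e2[symmetric] using that
      by (intro sublinear_conic_combination[OF F]) auto
    ultimately have "k * r \<le> (- D s' t') * f s t + D s t * f s' t'"
      using f[of s t] f[of s' t'] that by simp
    moreover have "k * r = L (k * A1) (k * A2)"
      using A(3) by (simp add: L_def flip: distrib_left)
    moreover have "L (k * A1) (k * A2) = (- D s' t') * L s t + D s t * L s' t'"
      unfolding e1[symmetric] e2[symmetric] by (simp add: L_def algebra_simps add_divide_distrib)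
    ultimately have "0 \<le> (- D s' t') * (f s t - L s t) + D s t * (f s' t' - L s' t')"
      by (simp add: algebra_simps)
    then show ?thesis
      using that(3,7) by (simp add: divide_simps algebra_simps mult_neg_pos)
  qed
  define S where "S = {(f s t - L s t) / D s t | s t. 0 \<le> s \<and> 0 \<le> t \<and> D s t > 0 \<and> F s t \<noteq> \<infinity>}"
  define c where "c = Inf S"
  have D1: "D s1 t1 > 0" and D2: "D s2 t2 < 0"
    using z1 z2 by (auto simp: D_def)
  have S_ne: "S \<noteq> {}"
    using z1 D1 by (auto simp: S_def)
  have lb: "(f s t - L s t) / D s t \<le> x"
    if "0 \<le> s" "0 \<le> t" "D s t < 0" "F s t \<noteq> \<infinity>" "x \<in> S" for s t x
    using that slope by (auto simp: S_def)
  have bdd: "bdd_below S"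
    using lb[OF z2(1,2) D2 z2(4)] by (rule bdd_belowI)
  have bound: "L u v + c * D u v \<le> f u v" if uv: "0 \<le> u" "0 \<le> v" "F u v \<noteq> \<infinity>" for u v
  proof (cases "D u v" "0 :: real" rule: linorder_cases)
    case less
    have "(f u v - L u v) / D u v \<le> c"
      unfolding c_def using S_ne lb[OF uv(1,2) less uv(3)] by (rule cInf_greatest)
    then show ?thesis using less by (simp add: divide_simps)
  next
    case greater
    have "c \<le> (f u v - L u v) / D u v"
      unfolding c_def using uv greater by (intro cInf_lower bdd) (auto simp: S_def)
    then show ?thesis using greater by (simp add: divide_simps)
  next
    case equal
    define k where "k = (u + v) / (A1 + A2)"
    have "u = k * A1" "v = k * A2"
      using equal A(3) by (auto simp: k_def D_def field_simps)
    moreover have "F (k * A1) (k * A2) = ereal (k * r)"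
      using A uv by (subst sublinear_scale[OF F]) (auto simp: k_def)
    ultimately have "f u v = k * r" by (simp add: f_def)
    moreover have "L u v = k * r" by (simp add: L_def k_def)
    ultimately show ?thesis using equal by (simp del: times_divide_eq_left times_divide_eq_right)
  qed
  show ?thesis
  proof (rule that)
    fix u v :: real assume uv: "0 \<le> u" "0 \<le> v"
    have "(r / (A1 + A2) + c * A2) * u + (r / (A1 + A2) - c * A1) * v = L u v + c * D u v"
      by (simp add: L_def D_def algebra_simps add_divide_distrib)
    then show "ereal ((r / (A1 + A2) + c * A2) * u + (r / (A1 + A2) - c * A1) * v) \<le> F u v"
      using f[OF uv] bound[OF uv] by (cases "F u v = \<infinity>") auto
  next
    show "(r / (A1 + A2) + c * A2) * A1 + (r / (A1 + A2) - c * A1) * A2 = r"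
    proof -
      have "(k + c * A2) * A1 + (k - c * A1) * A2 = k * (A1 + A2)" for k
        by (simp add: algebra_simps)
      then show ?thesis using A(3) by simp
    qed
  qed
qed

lemma entropy_function_sublinear:
  assumes "entropy_function \<Phi>"
  shows "sublinear \<Phi>"
proof -
  note \<Phi> = assms[unfolded entropy_function_def]
  note nm = \<Phi>[THEN conjunct1]
    and conv = \<Phi>[THEN conjunct2, THEN conjunct1, rule_format]
    and hom = \<Phi>[THEN conjunct2, THEN conjunct2, THEN conjunct1, rule_format]
  have "\<Phi> (u + u') (v + v') \<le> \<Phi> u v + \<Phi> u' v'"
    if uv: "0 \<le> u" "0 \<le> v" "0 \<le> u'" "0 \<le> v'" for u v u' v'
  proof -
    have "\<Phi> ((1 - 1/2) * (2 * u) + 1/2 * (2 * u')) ((1 - 1/2) * (2 * v) + 1/2 * (2 * v'))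
        \<le> ereal (1 - 1/2) * \<Phi> (2 * u) (2 * v) + ereal (1/2) * \<Phi> (2 * u') (2 * v')"
      using uv by (intro conv) auto
    also have "\<dots> = \<Phi> ((1/2) * (2 * u)) ((1/2) * (2 * v)) + \<Phi> ((1/2) * (2 * u')) ((1/2) * (2 * v'))"
      using uv by (subst (1 2) hom) auto
    finally show ?thesis by simp
  qed
  then show ?thesis using hom nm unfolding sublinear_def by (intro conjI) simp_all
qed

text \<open>A supporting functional at \<open>(1, 1)\<close> vanishes there, so it is a multiple of \<open>u - v\<close>. It may fail to
exist, as for the function that is infinite if \<open>u < v\<close> and \<open>- sqrt ((u - v) * (u + v))\<close> otherwise.\<close>

lemma entropy_function_trichotomy:
  assumes "entropy_function \<Phi>"
  shows "(\<exists>c. \<forall>u\<ge>0. \<forall>v\<ge>0. ereal (c * (u - v)) \<le> \<Phi> u v) \<or>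
    (\<forall>u\<ge>0. \<forall>v\<ge>0. v < u \<longrightarrow> \<Phi> u v = \<infinity>) \<or> (\<forall>u\<ge>0. \<forall>v\<ge>0. u < v \<longrightarrow> \<Phi> u v = \<infinity>)"
proof (cases "(\<forall>u\<ge>0. \<forall>v\<ge>0. v < u \<longrightarrow> \<Phi> u v = \<infinity>) \<or> (\<forall>u\<ge>0. \<forall>v\<ge>0. u < v \<longrightarrow> \<Phi> u v = \<infinity>)")
  case True
  then show ?thesis by (rule disjI2)
next
  case False
  then obtain s1 t1 s2 t2 where z1: "0 \<le> s1" "0 \<le> t1" "s1 * 1 > t1 * 1" "\<Phi> s1 t1 \<noteq> \<infinity>"
    and z2: "0 \<le> s2" "0 \<le> t2" "s2 * 1 < t2 * 1" "\<Phi> s2 t2 \<noteq> \<infinity>"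
    by auto
  have one: "0 \<le> (1::real)" "0 < 1 + (1::real)" "\<Phi> 1 1 = ereal 0"
    using assms by (auto simp: entropy_function_def)
  obtain \<alpha> \<beta> where *: "\<And>u v. 0 \<le> u \<Longrightarrow> 0 \<le> v \<Longrightarrow> ereal (\<alpha> * u + \<beta> * v) \<le> \<Phi> u v"
    and "\<alpha> * 1 + \<beta> * 1 = 0"
    by (rule sublinear_support[OF entropy_function_sublinear[OF assms] one(1,1,2,3) z1 z2]) (rule that)
  then have "\<beta> = - \<alpha>" by simp
  then have "ereal (\<alpha> * (u - v)) \<le> \<Phi> u v" if "0 \<le> u" "0 \<le> v" for u v
    using *[OF that] by (simp add: algebra_simps)
  then show ?thesis by (intro disjI1 exI[of _ \<alpha>]) simp
qed

section \<open>Nonnegative entropies: measurability and Jensen's inequality\<close>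

text \<open>The values lie in \<^typ>\<open>ennreal\<close> so that Fubini's theorem and monotone estimates apply without
integrability conditions.\<close>

definition nonneg_entropy :: "(real \<Rightarrow> real \<Rightarrow> ennreal) \<Rightarrow> bool" where
  "nonneg_entropy \<psi> \<longleftrightarrow> sublinear (\<lambda>u v. enn2ereal (\<psi> u v)) \<and> \<psi> 1 1 = 0"

lemma nonneg_entropy_add:
  assumes "nonneg_entropy \<psi>" "0 \<le> u" "0 \<le> v" "0 \<le> u'" "0 \<le> v'"
  shows "\<psi> (u + u') (v + v') \<le> \<psi> u v + \<psi> u' v'"
  using assms unfolding nonneg_entropy_def sublinear_def
  by (simp add: less_eq_ennreal.rep_eq plus_ennreal.rep_eq)

lemma nonneg_entropy_scale:
  assumes "nonneg_entropy \<psi>" "0 \<le> a" "0 \<le> u" "0 \<le> v"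
  shows "\<psi> (a * u) (a * v) = ennreal a * \<psi> u v"
proof -
  have "enn2ereal (\<psi> (a * u) (a * v)) = enn2ereal (ennreal a * \<psi> u v)"
    using assms unfolding nonneg_entropy_def sublinear_def
    by (simp add: times_ennreal.rep_eq)
  then show ?thesis by (simp add: enn2ereal_inject)
qed

lemma nonneg_entropy_diag:
  assumes "nonneg_entropy \<psi>" "0 \<le> a"
  shows "\<psi> a a = 0"
  using nonneg_entropy_scale[OF assms(1) assms(2), of 1 1] assms(1)
  by (simp add: nonneg_entropy_def)

text \<open>By homogeneity only the restriction of \<open>\<psi>\<close> to the segment \<open>u + v = 1\<close> matters, and the sublevel
sets of a convex function on a segment are intervals.\<close>

lemma nonneg_entropy_measurable:
  fixes \<psi> :: "real \<Rightarrow> real \<Rightarrow> ennreal"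
  assumes \<psi>: "nonneg_entropy \<psi>"
    and [measurable]: "f \<in> borel_measurable M" "g \<in> borel_measurable M"
    and nn: "\<And>x. 0 \<le> f x" "\<And>x. 0 \<le> g x"
  shows "(\<lambda>x. \<psi> (f x) (g x)) \<in> borel_measurable M"
proof -
  (* the value \<infinity> outside the unit interval keeps finite sublevel sets inside it *)
  define q where "q t = (if t \<in> {0..1} then \<psi> t (1 - t) else \<infinity>)" for t :: real
  have [measurable]: "q \<in> borel_measurable borel"
  proof (rule borel_measurableI_le)
    fix y :: ennreal
    have "is_interval {t. q t \<le> y}" if "y \<noteq> \<infinity>"
      unfolding is_interval_1
    proof (intro ballI allI impI, elim conjE)
      fix a b x assume ab: "a \<in> {t. q t \<le> y}" "b \<in> {t. q t \<le> y}" "a \<le> x" "x \<le> b"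
      then have a: "a \<in> {0..1}" "\<psi> a (1 - a) \<le> y" and b: "b \<in> {0..1}" "\<psi> b (1 - b) \<le> y"
        using that by (auto simp: q_def top_unique split: if_splits)
      have "x \<in> closed_segment a b" using ab by (simp add: closed_segment_eq_real_ivl)
      then obtain t where t: "0 \<le> t" "t \<le> 1" "x = (1 - t) * a + t * b"
        by (auto simp: closed_segment_def)
      have e: "1 - x = (1 - t) * (1 - a) + t * (1 - b)" by (simp add: t(3) algebra_simps)
      have "\<psi> x (1 - x) \<le> \<psi> ((1 - t) * a) ((1 - t) * (1 - a)) + \<psi> (t * b) (t * (1 - b))"
        unfolding e unfolding t(3) using a b t by (intro nonneg_entropy_add[OF \<psi>]) auto
      also have "\<dots> = ennreal (1 - t) * \<psi> a (1 - a) + ennreal t * \<psi> b (1 - b)"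
        using a b t by (subst (1 2) nonneg_entropy_scale[OF \<psi>]) auto
      also have "\<dots> \<le> ennreal (1 - t) * y + ennreal t * y"
        using a b by (intro add_mono mult_left_mono) auto
      also have "\<dots> = y"
        using t by (simp flip: distrib_right ennreal_plus)
      finally show "x \<in> {t. q t \<le> y}"
        using ab a b by (auto simp: q_def)
    qed
    then have "{t. q t \<le> y} \<in> sets borel"
      by (cases "y = \<infinity>") (auto intro: real_interval_borel_measurable)
    then show "{x \<in> space borel. q x \<le> y} \<in> sets borel" by simp
  qed
  have "\<psi> (f x) (g x) = ennreal (f x + g x) * q (f x / (f x + g x))" for x
  proof (cases "f x + g x = 0")
    case True
    then have "f x = 0" "g x = 0" using nn[of x] by auto
    then show ?thesis using nonneg_entropy_diag[OF \<psi>, of 0] by simp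
  next
    case False
    then have pos: "0 < f x + g x" using nn[of x] by auto
    have "1 - f x / (f x + g x) = g x / (f x + g x)" using pos by (simp add: field_simps)
    then have "q (f x / (f x + g x)) = \<psi> (f x / (f x + g x)) (g x / (f x + g x))"
      using nn[of x] pos by (simp add: q_def)
    then show ?thesis
      using nonneg_entropy_scale[OF \<psi>, of "f x + g x" "f x / (f x + g x)" "g x / (f x + g x)"]
        nn[of x] pos by simp
  qed
  then show ?thesis by simp
qed

text \<open>Homogeneity takes the place of a normalisation of the measure. Suppose that the right-hand side
is finite, and let \<open>(A1, A2)\<close> be the point of integrals. If \<open>(a, b)\<close> lies on both sides of the ray
through it, then \<open>\<psi>\<close> is finite at points of both sides, and integrating a supporting functional
gives the claim. Otherwise \<open>(a, b)\<close> stays almost everywhere on the ray, and homogeneity gives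
equality.\<close>

lemma nonneg_entropy_Jensen:
  fixes a b :: "'a \<Rightarrow> real"
  assumes \<psi>: "nonneg_entropy \<psi>"
    and int: "integrable M a" "integrable M b"
    and nn: "\<And>x. 0 \<le> a x" "\<And>x. 0 \<le> b x"
  shows "\<psi> (\<integral>x. a x \<partial>M) (\<integral>x. b x \<partial>M) \<le> (\<integral>\<^sup>+x. \<psi> (a x) (b x) \<partial>M)"
proof (cases "(\<integral>\<^sup>+x. \<psi> (a x) (b x) \<partial>M) = \<infinity>")
  case False
  have [measurable]: "a \<in> borel_measurable M" "b \<in> borel_measurable M"
    using int by auto
  have [measurable]: "(\<lambda>x. \<psi> (a x) (b x)) \<in> borel_measurable M"
    using \<psi> nn by (intro nonneg_entropy_measurable) auto
  define A1 where "A1 = (\<integral>x. a x \<partial>M)"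
  define A2 where "A2 = (\<integral>x. b x \<partial>M)"
  have A: "0 \<le> A1" "0 \<le> A2" using nn by (auto simp: A1_def A2_def)
  have fin: "AE x in M. \<psi> (a x) (b x) \<noteq> \<infinity>"
    using False by (intro nn_integral_noteq_infinite) auto
  define D where "D x = a x * A2 - b x * A1" for x
  have D_int: "integrable M D" "(\<integral>x. D x \<partial>M) = 0"
    using int by (auto simp: D_def[abs_def] A1_def A2_def)
  (* D measures the deviation of (a, b) from the ray through (A1, A2); its integral is 0, so it
     vanishes almost everywhere or takes both signs *)
  consider "A1 + A2 = 0" | "0 < A1 + A2" "AE x in M. D x = 0"
    | "0 < A1 + A2" "\<not> (AE x in M. D x \<le> 0)" "\<not> (AE x in M. D x \<ge> 0)"
  proof -
    have "AE x in M. D x = 0" if "AE x in M. D x \<le> 0"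
      using integral_nonneg_eq_0_iff_AE[of M "\<lambda>x. - D x"] that D_int by simp
    moreover have "AE x in M. D x = 0" if "AE x in M. D x \<ge> 0"
      using integral_nonneg_eq_0_iff_AE[of M D] that D_int by simp
    ultimately show ?thesis using that A by linarith
  qed
  then show ?thesis
  proof cases
    case 1
    then have "A1 = 0" "A2 = 0" using A by auto
    then show ?thesis using nonneg_entropy_diag[OF \<psi>, of 0] by (simp add: A1_def A2_def)
  next
    case 2
    define s where "s x = (a x + b x) / (A1 + A2)" for x
    have s: "a x = s x * A1 \<and> b x = s x * A2" if "D x = 0" for x
      using that 2(1) by (auto simp: D_def s_def field_simps)
    have s_nn: "0 \<le> s x" for x using nn A by (simp add: s_def)
    have "(\<integral>\<^sup>+x. \<psi> (a x) (b x) \<partial>M) = (\<integral>\<^sup>+x. ennreal (s x) * \<psi> A1 A2 \<partial>M)"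
    proof (rule nn_integral_cong_AE)
      show "AE x in M. \<psi> (a x) (b x) = ennreal (s x) * \<psi> A1 A2"
        using 2(2)
      proof eventually_elim
        case (elim x)
        then show ?case
          using s[OF elim] nonneg_entropy_scale[OF \<psi> s_nn[of x] A] by simp
      qed
    qed
    also have "\<dots> = (\<integral>\<^sup>+x. ennreal (s x) \<partial>M) * \<psi> A1 A2"
      by (rule nn_integral_multc) (simp add: s_def)
    also have "(\<integral>\<^sup>+x. ennreal (s x) \<partial>M) = ennreal (\<integral>x. s x \<partial>M)"
      using int s_nn by (intro nn_integral_eq_integral) (auto simp: s_def)
    also have "(\<integral>x. s x \<partial>M) = 1"
      using int 2(1) by (simp add: s_def A1_def A2_def)
    finally show ?thesis by (simp add: A1_def A2_def)
  next
    case 3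
    have "\<not> (AE x in M. \<psi> (a x) (b x) \<noteq> \<infinity> \<longrightarrow> D x \<le> 0)"
    proof
      assume "AE x in M. \<psi> (a x) (b x) \<noteq> \<infinity> \<longrightarrow> D x \<le> 0"
      with fin have "AE x in M. D x \<le> 0" by eventually_elim simp
      then show False using 3(2) by simp
    qed
    then have "\<exists>x. \<psi> (a x) (b x) \<noteq> \<infinity> \<and> D x > 0"
      by (rule contrapos_np) (auto simp: not_less intro!: AE_I2)
    then obtain x1 where x1: "\<psi> (a x1) (b x1) \<noteq> \<infinity>" "D x1 > 0" by blast
    have "\<not> (AE x in M. \<psi> (a x) (b x) \<noteq> \<infinity> \<longrightarrow> D x \<ge> 0)"
    proof
      assume "AE x in M. \<psi> (a x) (b x) \<noteq> \<infinity> \<longrightarrow> D x \<ge> 0"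
      with fin have "AE x in M. D x \<ge> 0" by eventually_elim simp
      then show False using 3(3) by simp
    qed
    then have "\<exists>x. \<psi> (a x) (b x) \<noteq> \<infinity> \<and> D x < 0"
      by (rule contrapos_np) (auto simp: not_less intro!: AE_I2)
    then obtain x2 where x2: "\<psi> (a x2) (b x2) \<noteq> \<infinity>" "D x2 < 0" by blast
    (* a positive combination of the values at x1 and x2 is k * (A1, A2), so \<psi> A1 A2 is finite *)
    define k where "k = a x1 * b x2 - a x2 * b x1"
    have e: "(- D x2) * a x1 + D x1 * a x2 = k * A1" "(- D x2) * b x1 + D x1 * b x2 = k * A2"
      by (auto simp: D_def k_def algebra_simps)
    have F: "sublinear (\<lambda>u v. enn2ereal (\<psi> u v))" using \<psi> by (simp add: nonneg_entropy_def)
    have k: "k > 0"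
    proof (rule ccontr)
      assume "\<not> 0 < k"
      then have "k * A1 \<le> 0" "k * A2 \<le> 0" using A by (auto simp: mult_le_0_iff)
      moreover have "(- D x2) * a x1 \<ge> 0" "D x1 * a x2 \<ge> 0" "(- D x2) * b x1 \<ge> 0" "D x1 * b x2 \<ge> 0"
        using x1 x2 nn by (auto simp: mult_le_0_iff less_imp_le)
      ultimately have "(- D x2) * a x1 = 0" "(- D x2) * b x1 = 0"
        using e by linarith+
      then have "a x1 = 0" "b x1 = 0" using x2 by auto
      then show False using x1 by (simp add: D_def)
    qed
    have "ennreal k * \<psi> A1 A2 = \<psi> (k * A1) (k * A2)"
      using k A by (simp add: nonneg_entropy_scale[OF \<psi>])
    also have "\<dots> \<le> \<psi> ((- D x2) * a x1) ((- D x2) * b x1) + \<psi> (D x1 * a x2) (D x1 * b x2)"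
      unfolding e[symmetric] using x1 x2 nn
      by (intro nonneg_entropy_add[OF \<psi>]) (auto simp: mult_le_0_iff less_imp_le)
    also have "\<dots> = ennreal (- D x2) * \<psi> (a x1) (b x1) + ennreal (D x1) * \<psi> (a x2) (b x2)"
      using x1 x2 nn by (subst (1 2) nonneg_entropy_scale[OF \<psi>]) auto
    also have "\<dots> < \<infinity>"
      using x1 x2 by (auto simp: ennreal_mult_less_top less_top)
    finally have "\<psi> A1 A2 \<noteq> \<infinity>" using k by (auto simp: ennreal_mult_less_top)
    then obtain r where r: "\<psi> A1 A2 = ennreal r" "0 \<le> r"
      by (metis ennreal_cases infinity_ennreal_def)
    have r': "enn2ereal (\<psi> A1 A2) = ereal r" using r by simp
    have "a x1 * A2 > b x1 * A1" "enn2ereal (\<psi> (a x1) (b x1)) \<noteq> \<infinity>"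
      "a x2 * A2 < b x2 * A1" "enn2ereal (\<psi> (a x2) (b x2)) \<noteq> \<infinity>"
      using x1 x2 by (auto simp: D_def)
    note side = this
    obtain \<alpha> \<beta> where sup: "\<And>u v. 0 \<le> u \<Longrightarrow> 0 \<le> v \<Longrightarrow> ereal (\<alpha> * u + \<beta> * v) \<le> enn2ereal (\<psi> u v)"
      and eq: "\<alpha> * A1 + \<beta> * A2 = r"
      by (rule sublinear_support[OF F A 3(1) r' nn side(1,2) nn side(3,4)]) (rule that)
    have sup': "ennreal (\<alpha> * u + \<beta> * v) \<le> \<psi> u v" if "0 \<le> u" "0 \<le> v" for u v
      using e2ennreal_mono[OF sup[OF that]] by simp
    have int': "integrable M (\<lambda>x. max 0 (\<alpha> * a x + \<beta> * b x))"
      using int by (intro integrable_max) auto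
    have "\<psi> A1 A2 = ennreal (\<integral>x. \<alpha> * a x + \<beta> * b x \<partial>M)"
      using int eq r by (simp add: A1_def A2_def)
    also have "\<dots> \<le> ennreal (\<integral>x. max 0 (\<alpha> * a x + \<beta> * b x) \<partial>M)"
      using int int' by (intro ennreal_leI integral_mono) auto
    also have "\<dots> = (\<integral>\<^sup>+x. ennreal (\<alpha> * a x + \<beta> * b x) \<partial>M)"
      by (subst nn_integral_eq_integral[OF int', symmetric])
        (auto simp: max_def ennreal_neg intro!: nn_integral_cong)
    also have "\<dots> \<le> (\<integral>\<^sup>+x. \<psi> (a x) (b x) \<partial>M)"
      using nn by (intro nn_integral_mono sup') auto
    finally show ?thesis by (simp add: A1_def A2_def)
  qed
qed simp

section \<open>Contraction of entropies by kernels with small Dobrushin coefficient\<close>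

lemma kernel_push_mass:
  fixes p :: "'a \<Rightarrow> real" and k :: "'a \<Rightarrow> 'b \<Rightarrow> real"
  assumes M: "sigma_finite_measure M" and N: "sigma_finite_measure N"
    and p_meas [measurable]: "p \<in> borel_measurable M" and p_nn: "\<And>x. 0 \<le> p x"
    and k_meas [measurable]: "(\<lambda>(x, y). k x y) \<in> borel_measurable (M \<Otimes>\<^sub>M N)"
    and k_nn: "\<And>x y. 0 \<le> k x y"
    and k_int: "AE x in M. (\<integral>\<^sup>+y. ennreal (k x y) \<partial>N) = 1"
  shows "(\<integral>\<^sup>+y. \<integral>\<^sup>+x. ennreal (p x * k x y) \<partial>M \<partial>N) = (\<integral>\<^sup>+x. ennreal (p x) \<partial>M)"
proof -
  interpret M: sigma_finite_measure M by fact
  interpret N: sigma_finite_measure N by fact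
  interpret MN: pair_sigma_finite M N ..
  have "(\<integral>\<^sup>+y. \<integral>\<^sup>+x. ennreal (p x * k x y) \<partial>M \<partial>N) = (\<integral>\<^sup>+x. \<integral>\<^sup>+y. ennreal (p x * k x y) \<partial>N \<partial>M)"
    by (rule MN.Fubini') measurable
  also have "\<dots> = (\<integral>\<^sup>+x. ennreal (p x) * (\<integral>\<^sup>+y. ennreal (k x y) \<partial>N) \<partial>M)"
    using p_nn k_nn by (intro nn_integral_cong) (simp add: ennreal_mult nn_integral_cmult)
  also have "\<dots> = (\<integral>\<^sup>+x. ennreal (p x) \<partial>M)"
    using k_int by (intro nn_integral_cong_AE) (auto elim: eventually_mono)
  finally show ?thesis .
qed

text \<open>The density of the image of a probability measure is finite only almost everywhere; passing to
its real part loses nothing.\<close>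

lemma kernel_push_density:
  fixes p :: "'a \<Rightarrow> real" and k :: "'a \<Rightarrow> 'b \<Rightarrow> real"
  assumes M: "sigma_finite_measure M" and N: "sigma_finite_measure N"
    and p_meas [measurable]: "p \<in> borel_measurable M" and p_nn: "\<And>x. 0 \<le> p x"
    and p_int: "(\<integral>\<^sup>+x. ennreal (p x) \<partial>M) = 1"
    and k_meas [measurable]: "(\<lambda>(x, y). k x y) \<in> borel_measurable (M \<Otimes>\<^sub>M N)"
    and k_nn: "\<And>x y. 0 \<le> k x y"
    and k_int: "AE x in M. (\<integral>\<^sup>+y. ennreal (k x y) \<partial>N) = 1"
  shows "(\<lambda>y. \<integral>\<^sup>+x. ennreal (p x * k x y) \<partial>M) \<in> borel_measurable N"
    and "AE y in N. ennreal (enn2real (\<integral>\<^sup>+x. ennreal (p x * k x y) \<partial>M)) = (\<integral>\<^sup>+x. ennreal (p x * k x y) \<partial>M)"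
    and "(\<integral>\<^sup>+y. ennreal (enn2real (\<integral>\<^sup>+x. ennreal (p x * k x y) \<partial>M)) \<partial>N) = 1"
proof -
  interpret M: sigma_finite_measure M by fact
  show meas [measurable]: "(\<lambda>y. \<integral>\<^sup>+x. ennreal (p x * k x y) \<partial>M) \<in> borel_measurable N"
    by measurable
  note mass = kernel_push_mass[OF M N p_meas p_nn k_meas k_nn k_int]
  have "AE y in N. (\<integral>\<^sup>+x. ennreal (p x * k x y) \<partial>M) \<noteq> \<infinity>"
    using mass p_int by (intro nn_integral_noteq_infinite) auto
  then show *: "AE y in N. ennreal (enn2real (\<integral>\<^sup>+x. ennreal (p x * k x y) \<partial>M)) = (\<integral>\<^sup>+x. ennreal (p x * k x y) \<partial>M)"
    by eventually_elim (simp add: less_top)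
  show "(\<integral>\<^sup>+y. ennreal (enn2real (\<integral>\<^sup>+x. ennreal (p x * k x y) \<partial>M)) \<partial>N) = 1"
    using mass p_int nn_integral_cong_AE[OF *] by simp
qed

text \<open>Below, \<open>h x\<close> is the part of the kernel at \<open>x\<close> that is shared with the points on the other side of
\<open>p1 = p2\<close>, averaged over these points with weight \<open>\<bar>p1 - p2\<bar>\<close>; \<open>kt\<close> is the rest.
The weights make the shared parts balance: \<open>p1\<close> and \<open>p2\<close> send the same mass through \<open>h\<close>
(fact \<open>h_bal\<close>), by the symmetry of \<open>min\<close> and Fubini's theorem.\<close>

lemma nonneg_entropy_kernel_contraction:
  fixes p1 p2 :: "'a \<Rightarrow> real" and k :: "'a \<Rightarrow> 'b \<Rightarrow> real"
  assumes \<psi>: "nonneg_entropy \<psi>"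
    and M: "sigma_finite_measure M" and N: "sigma_finite_measure N"
    and p_meas [measurable]: "p1 \<in> borel_measurable M" "p2 \<in> borel_measurable M"
    and p_nn: "\<And>x. 0 \<le> p1 x" "\<And>x. 0 \<le> p2 x"
    and p_int: "(\<integral>\<^sup>+x. ennreal (p1 x) \<partial>M) = 1" "(\<integral>\<^sup>+x. ennreal (p2 x) \<partial>M) = 1"
    and k_meas: "(\<lambda>(x, y). k x y) \<in> borel_measurable (M \<Otimes>\<^sub>M N)"
    and k_nn: "\<And>x y. 0 \<le> k x y"
    and k_int: "AE x in M. (\<integral>\<^sup>+y. ennreal (k x y) \<partial>N) = 1"
    and \<delta>: "0 \<le> \<delta>" "\<delta> \<le> 1"
    and overlap: "AE x in M. AE z in M. ennreal (1 - \<delta>) \<le> (\<integral>\<^sup>+y. ennreal (min (k x y) (k z y)) \<partial>N)"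
  shows "(\<integral>\<^sup>+y. \<psi> (enn2real (\<integral>\<^sup>+x. ennreal (p1 x * k x y) \<partial>M))
                  (enn2real (\<integral>\<^sup>+x. ennreal (p2 x * k x y) \<partial>M)) \<partial>N)
         \<le> ennreal \<delta> * (\<integral>\<^sup>+x. \<psi> (p1 x) (p2 x) \<partial>M)"
proof -
  interpret M: sigma_finite_measure M by fact
  interpret N: sigma_finite_measure N by fact
  interpret MN: pair_sigma_finite M N ..
  interpret MM: pair_sigma_finite M M ..
  have k_meas' [measurable (raw)]: "(\<lambda>w. k (f w) (g w)) \<in> borel_measurable L"
    if [measurable]: "f \<in> L \<rightarrow>\<^sub>M M" "g \<in> L \<rightarrow>\<^sub>M N" for L :: "'c measure" and f g
    using measurable_compose[OF _ k_meas, of "\<lambda>w. (f w, g w)" L] by simp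
  define ep where "ep x = max 0 (p1 x - p2 x)" for x
  define em where "em x = max 0 (p2 x - p1 x)" for x
  define mn where "mn x = min (p1 x) (p2 x)" for x
  have [measurable]: "ep \<in> borel_measurable M" "em \<in> borel_measurable M" "mn \<in> borel_measurable M"
    unfolding ep_def[abs_def] em_def[abs_def] mn_def[abs_def] by measurable
  have nn [simp]: "0 \<le> ep x" "0 \<le> em x" "0 \<le> mn x" for x
    using p_nn by (auto simp: ep_def em_def mn_def)
  have split: "p1 x = mn x + ep x" "p2 x = mn x + em x" for x
    by (auto simp: ep_def em_def mn_def)
  have mn_fin: "(\<integral>\<^sup>+x. mn x \<partial>M) \<noteq> \<infinity>"
  proof -
    have "(\<integral>\<^sup>+x. mn x \<partial>M) \<le> (\<integral>\<^sup>+x. p1 x \<partial>M)"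
      by (intro nn_integral_mono ennreal_leI) (simp add: mn_def)
    then show ?thesis using p_int by (auto simp: top_unique)
  qed
  have sum1: "(\<integral>\<^sup>+x. mn x \<partial>M) + (\<integral>\<^sup>+x. ep x \<partial>M) = 1"
    using p_int(1) unfolding split by (simp add: nn_integral_add)
  have sum2: "(\<integral>\<^sup>+x. mn x \<partial>M) + (\<integral>\<^sup>+x. em x \<partial>M) = 1"
    using p_int(2) unfolding split by (simp add: nn_integral_add)
  have em_eq: "(\<integral>\<^sup>+x. em x \<partial>M) = (\<integral>\<^sup>+x. ep x \<partial>M)"
    using sum1 sum2 mn_fin by (metis ennreal_add_left_cancel infinity_ennreal_def)
  have "(\<integral>\<^sup>+x. ep x \<partial>M) \<le> 1"
    unfolding sum1[symmetric] by simp
  then obtain m where m: "(\<integral>\<^sup>+x. ep x \<partial>M) = ennreal m" "0 \<le> m"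
    by (cases "\<integral>\<^sup>+x. ep x \<partial>M") (auto simp: top_unique)
  show ?thesis
  proof (cases "m = 0")
    case True
    then have "(\<integral>\<^sup>+x. ep x \<partial>M) = 0" "(\<integral>\<^sup>+x. em x \<partial>M) = 0"
      using m em_eq by auto
    then have "AE x in M. ep x = 0" "AE x in M. em x = 0"
      by (simp_all add: nn_integral_0_iff_AE antisym_conv)
    then have eq: "AE x in M. p1 x = p2 x"
      by eventually_elim (simp add: split)
    have "(\<integral>\<^sup>+x. ennreal (p1 x * k x y) \<partial>M) = (\<integral>\<^sup>+x. ennreal (p2 x * k x y) \<partial>M)" for y
      using eq by (intro nn_integral_cong_AE) (auto elim: eventually_mono)
    then show ?thesis using nonneg_entropy_diag[OF \<psi>] by simp
  next
    case False
    then have m_pos: "0 < m" using m by simp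
    define h where "h x y =
      (if p2 x < p1 x then (\<integral>\<^sup>+z. ennreal (em z * min (k x y) (k z y)) \<partial>M) / ennreal m
       else if p1 x < p2 x then (\<integral>\<^sup>+z. ennreal (ep z * min (k x y) (k z y)) \<partial>M) / ennreal m
       else ennreal (k x y))" for x y
    have [measurable (raw)]: "(\<lambda>w. h (f w) (g w)) \<in> borel_measurable L"
      if [measurable]: "f \<in> L \<rightarrow>\<^sub>M M" "g \<in> L \<rightarrow>\<^sub>M N" for L :: "'c measure" and f g
      unfolding h_def by measurable
    have h_le: "h x y \<le> ennreal (k x y)" for x y
    proof -
      have *: "(\<integral>\<^sup>+z. ennreal (e z * min (k x y) (k z y)) \<partial>M) / ennreal m \<le> ennreal (k x y)"
        if e: "\<And>z. 0 \<le> e z" "(\<integral>\<^sup>+z. ennreal (e z) \<partial>M) = ennreal m" "e \<in> borel_measurable M" for e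
      proof -
        have "(\<integral>\<^sup>+z. ennreal (e z * min (k x y) (k z y)) \<partial>M) \<le> (\<integral>\<^sup>+z. ennreal (e z) * ennreal (k x y) \<partial>M)"
          using e k_nn by (intro nn_integral_mono) (auto simp flip: ennreal_mult intro!: ennreal_leI mult_left_mono)
        also have "\<dots> = ennreal m * ennreal (k x y)"
          using e by (simp add: nn_integral_multc)
        finally show ?thesis
          using m_pos by (simp add: divide_le_posI_ennreal)
      qed
      show ?thesis
        using *[of em] *[of ep] m em_eq by (simp add: h_def)
    qed
    have h_fin: "h x y \<noteq> \<infinity>" for x y
      using h_le[of x y] by (auto simp: top_unique)
    define kt where "kt x y = k x y - enn2real (h x y)" for x y
    have kt_meas [measurable (raw)]: "(\<lambda>w. kt (f w) (g w)) \<in> borel_measurable L"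
      if [measurable]: "f \<in> L \<rightarrow>\<^sub>M M" "g \<in> L \<rightarrow>\<^sub>M N" for L :: "'c measure" and f g
      unfolding kt_def by measurable
    have kt_nn: "0 \<le> kt x y" for x y
      using enn2real_mono[OF h_le[of x y]] k_nn[of x y] by (simp add: kt_def)
    have k_split: "ennreal (k x y) = ennreal (kt x y) + h x y" for x y
    proof -
      have "h x y = ennreal (enn2real (h x y))" using h_fin[of x y] by (simp add: less_top)
      then have "ennreal (kt x y) + h x y = ennreal (kt x y) + ennreal (enn2real (h x y))"
        by simp
      also have "\<dots> = ennreal (k x y)"
        using kt_nn[of x y] by (subst ennreal_plus[symmetric]) (auto simp: kt_def)
      finally show ?thesis ..
    qed
    have h_mass: "AE x in M. ennreal (1 - \<delta>) \<le> (\<integral>\<^sup>+y. h x y \<partial>N)"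
      using overlap k_int AE_space
    proof eventually_elim
      case (elim x)
      note [measurable] = elim(3)
      have *: "ennreal (1 - \<delta>) \<le> (\<integral>\<^sup>+y. (\<integral>\<^sup>+z. ennreal (e z * min (k x y) (k z y)) \<partial>M) / ennreal m \<partial>N)"
        if e: "\<And>z. 0 \<le> e z" "(\<integral>\<^sup>+z. ennreal (e z) \<partial>M) = ennreal m" "e \<in> borel_measurable M" for e
      proof -
        note [measurable] = e(3)
        have "ennreal (1 - \<delta>) * ennreal m = (\<integral>\<^sup>+z. ennreal (e z) * ennreal (1 - \<delta>) \<partial>M)"
          using e by (simp add: nn_integral_multc mult.commute)
        also have "\<dots> \<le> (\<integral>\<^sup>+z. ennreal (e z) * (\<integral>\<^sup>+y. ennreal (min (k x y) (k z y)) \<partial>N) \<partial>M)"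
          using elim(1) by (intro nn_integral_mono_AE) (auto elim!: eventually_mono intro!: mult_left_mono)
        also have "\<dots> = (\<integral>\<^sup>+z. (\<integral>\<^sup>+y. ennreal (e z * min (k x y) (k z y)) \<partial>N) \<partial>M)"
          using e k_nn by (intro nn_integral_cong) (simp add: ennreal_mult nn_integral_cmult)
        also have "\<dots> = (\<integral>\<^sup>+y. (\<integral>\<^sup>+z. ennreal (e z * min (k x y) (k z y)) \<partial>M) \<partial>N)"
          by (rule MN.Fubini'[symmetric]) measurable
        finally have "ennreal (1 - \<delta>) * ennreal m / ennreal m
            \<le> (\<integral>\<^sup>+y. (\<integral>\<^sup>+z. ennreal (e z * min (k x y) (k z y)) \<partial>M) \<partial>N) / ennreal m"
          by (rule divide_right_mono_ennreal)
        also have "\<dots> = (\<integral>\<^sup>+y. (\<integral>\<^sup>+z. ennreal (e z * min (k x y) (k z y)) \<partial>M) / ennreal m \<partial>N)"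
          by (rule nn_integral_divide[symmetric]) measurable
        finally show ?thesis
          using m_pos by (simp add: ennreal_mult_divide_eq)
      qed
      show ?case
        using *[of em] *[of ep] m em_eq elim(2) \<delta>
        by (cases "p1 x" "p2 x" rule: linorder_cases) (simp_all add: h_def)
    qed
    have kt_mass: "AE x in M. (\<integral>\<^sup>+y. ennreal (kt x y) \<partial>N) \<le> ennreal \<delta>"
      using h_mass k_int AE_space
    proof eventually_elim
      case (elim x)
      note [measurable] = elim(3)
      have "(\<integral>\<^sup>+y. ennreal (kt x y) \<partial>N) + (\<integral>\<^sup>+y. h x y \<partial>N) = 1"
        using elim(2) unfolding k_split by (subst (asm) nn_integral_add) auto
      then have "(\<integral>\<^sup>+y. ennreal (kt x y) \<partial>N) + ennreal (1 - \<delta>) \<le> 1"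
        using elim(1) by (metis add_left_mono)
      also have "1 = ennreal \<delta> + ennreal (1 - \<delta>)"
        using \<delta> by (simp flip: ennreal_plus)
      finally show ?case by simp
    qed
    have h_bal: "(\<integral>\<^sup>+x. ennreal (p1 x) * h x y \<partial>M) = (\<integral>\<^sup>+x. ennreal (p2 x) * h x y \<partial>M)"
      if [measurable]: "y \<in> space N" for y
    proof -
      have "(\<integral>\<^sup>+x. ennreal (ep x) * h x y \<partial>M)
          = (\<integral>\<^sup>+x. \<integral>\<^sup>+z. ennreal (ep x * em z * min (k x y) (k z y)) / ennreal m \<partial>M \<partial>M)"
      proof (rule nn_integral_cong)
        fix x assume [measurable]: "x \<in> space M"
        have "(\<integral>\<^sup>+z. ennreal (ep x * em z * min (k x y) (k z y)) / ennreal m \<partial>M)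
            = ennreal (ep x) * ((\<integral>\<^sup>+z. ennreal (em z * min (k x y) (k z y)) \<partial>M) / ennreal m)"
          using k_nn by (simp add: nn_integral_divide ennreal_mult mult.assoc nn_integral_cmult ennreal_times_divide)
        then show "ennreal (ep x) * h x y = (\<integral>\<^sup>+z. ennreal (ep x * em z * min (k x y) (k z y)) / ennreal m \<partial>M)"
          by (cases "p2 x < p1 x") (auto simp: h_def ep_def max_def)
      qed
      also have "\<dots> = (\<integral>\<^sup>+z. \<integral>\<^sup>+x. ennreal (ep x * em z * min (k x y) (k z y)) / ennreal m \<partial>M \<partial>M)"
        by (rule MM.Fubini') measurable
      also have "\<dots> = (\<integral>\<^sup>+z. ennreal (em z) * h z y \<partial>M)"
      proof (rule nn_integral_cong)
        fix x assume [measurable]: "x \<in> space M"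
        have "(\<integral>\<^sup>+z. ennreal (ep z * em x * min (k z y) (k x y)) / ennreal m \<partial>M)
            = (\<integral>\<^sup>+z. ennreal (em x * (ep z * min (k x y) (k z y))) / ennreal m \<partial>M)"
          by (simp add: ac_simps min.commute)
        also have "\<dots> = ennreal (em x) * ((\<integral>\<^sup>+z. ennreal (ep z * min (k x y) (k z y)) \<partial>M) / ennreal m)"
          using k_nn by (simp add: nn_integral_divide ennreal_mult mult.assoc nn_integral_cmult ennreal_times_divide)
        finally show "(\<integral>\<^sup>+z. ennreal (ep z * em x * min (k z y) (k x y)) / ennreal m \<partial>M) = ennreal (em x) * h x y"
          by (cases "p1 x < p2 x") (auto simp: h_def em_def max_def)
      qed
      finally have "(\<integral>\<^sup>+x. ennreal (ep x) * h x y \<partial>M) = (\<integral>\<^sup>+x. ennreal (em x) * h x y \<partial>M)" .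
      then show ?thesis
        unfolding split by (simp add: distrib_right nn_integral_add)
    qed
    have fin: "AE y in N. (\<integral>\<^sup>+x. ennreal (p x * k x y) \<partial>M) \<noteq> \<infinity>"
      if p: "\<And>x. 0 \<le> p x" "(\<integral>\<^sup>+x. ennreal (p x) \<partial>M) = 1" and [measurable]: "p \<in> borel_measurable M" for p
      using kernel_push_density(2)[OF M N that(3) p k_meas k_nn k_int]
      by eventually_elim (metis ennreal_neq_top infinity_ennreal_def)
    have [measurable (raw)]: "(\<lambda>w. \<psi> (p1 (f w)) (p2 (f w))) \<in> borel_measurable L"
      if [measurable]: "f \<in> L \<rightarrow>\<^sub>M M" for L :: "'c measure" and f
      using p_nn by (intro nonneg_entropy_measurable[OF \<psi>]) auto
    have "(\<integral>\<^sup>+y. \<psi> (enn2real (\<integral>\<^sup>+x. ennreal (p1 x * k x y) \<partial>M))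
                  (enn2real (\<integral>\<^sup>+x. ennreal (p2 x * k x y) \<partial>M)) \<partial>N)
        \<le> (\<integral>\<^sup>+y. \<integral>\<^sup>+x. ennreal (kt x y) * \<psi> (p1 x) (p2 x) \<partial>M \<partial>N)"
    proof (rule nn_integral_mono_AE)
      show "AE y in N. \<psi> (enn2real (\<integral>\<^sup>+x. ennreal (p1 x * k x y) \<partial>M))
                  (enn2real (\<integral>\<^sup>+x. ennreal (p2 x * k x y) \<partial>M))
        \<le> (\<integral>\<^sup>+x. ennreal (kt x y) * \<psi> (p1 x) (p2 x) \<partial>M)"
        using fin[OF p_nn(1) p_int(1) p_meas(1)] fin[OF p_nn(2) p_int(2) p_meas(2)] AE_space
      proof eventually_elim
        case (elim y)
        note [measurable] = elim(3)
        define c where "c = (\<integral>\<^sup>+x. ennreal (p1 x) * h x y \<partial>M)"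
        have decomp: "integrable M (\<lambda>x. p x * kt x y)"
          "enn2real (\<integral>\<^sup>+x. ennreal (p x * k x y) \<partial>M) = enn2real c + (\<integral>x. p x * kt x y \<partial>M)"
          if p: "\<And>x. 0 \<le> p x" "(\<integral>\<^sup>+x. ennreal (p x * k x y) \<partial>M) \<noteq> \<infinity>"
            "(\<integral>\<^sup>+x. ennreal (p x) * h x y \<partial>M) = c"
            and [measurable]: "p \<in> borel_measurable M" for p
        proof -
          have eq: "(\<integral>\<^sup>+x. ennreal (p x * k x y) \<partial>M) = (\<integral>\<^sup>+x. ennreal (p x * kt x y) \<partial>M) + c"
            unfolding p(3)[symmetric] using p(1) k_nn kt_nn
            by (subst nn_integral_add[symmetric]) (auto simp: ennreal_mult k_split distrib_left)
          have c: "c < \<top>" and t: "(\<integral>\<^sup>+x. ennreal (p x * kt x y) \<partial>M) < \<top>"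
            using p(2) unfolding eq by (auto simp: less_top)
          show "integrable M (\<lambda>x. p x * kt x y)"
            using t p(1) kt_nn by (intro integrableI_nonneg) auto
          then have "(\<integral>\<^sup>+x. ennreal (p x * kt x y) \<partial>M) = ennreal (\<integral>x. p x * kt x y \<partial>M)"
            using p(1) kt_nn by (intro nn_integral_eq_integral) auto
          moreover have "0 \<le> (\<integral>x. p x * kt x y \<partial>M)"
            using p(1) kt_nn by (intro integral_nonneg_AE) auto
          ultimately show "enn2real (\<integral>\<^sup>+x. ennreal (p x * k x y) \<partial>M) = enn2real c + (\<integral>x. p x * kt x y \<partial>M)"
            unfolding eq using c by (simp add: enn2real_plus)
        qed
        note d1 = decomp[OF p_nn(1) elim(1) c_def[symmetric] p_meas(1)]
        note d2 = decomp[OF p_nn(2) elim(2) _ p_meas(2), unfolded c_def, OF h_bal[OF elim(3), symmetric], folded c_def]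
        have "\<psi> (enn2real c + (\<integral>x. p1 x * kt x y \<partial>M)) (enn2real c + (\<integral>x. p2 x * kt x y \<partial>M))
          \<le> \<psi> (enn2real c) (enn2real c) + \<psi> (\<integral>x. p1 x * kt x y \<partial>M) (\<integral>x. p2 x * kt x y \<partial>M)"
          using p_nn kt_nn by (intro nonneg_entropy_add[OF \<psi>] integral_nonneg_AE) auto
        also have "\<psi> (enn2real c) (enn2real c) = 0"
          by (rule nonneg_entropy_diag[OF \<psi>]) simp
        also have "0 + \<psi> (\<integral>x. p1 x * kt x y \<partial>M) (\<integral>x. p2 x * kt x y \<partial>M)
           \<le> (\<integral>\<^sup>+x. \<psi> (p1 x * kt x y) (p2 x * kt x y) \<partial>M)"
          using d1(1) d2(1) p_nn kt_nn by (simp add: nonneg_entropy_Jensen[OF \<psi>])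
        also have "\<dots> = (\<integral>\<^sup>+x. ennreal (kt x y) * \<psi> (p1 x) (p2 x) \<partial>M)"
          using nonneg_entropy_scale[OF \<psi> kt_nn p_nn] by (simp add: mult.commute)
        finally show ?case unfolding d1(2) d2(2) .
      qed
    qed
    also have "\<dots> = (\<integral>\<^sup>+x. \<integral>\<^sup>+y. ennreal (kt x y) * \<psi> (p1 x) (p2 x) \<partial>N \<partial>M)"
      by (rule MN.Fubini') measurable
    also have "\<dots> = (\<integral>\<^sup>+x. (\<integral>\<^sup>+y. ennreal (kt x y) \<partial>N) * \<psi> (p1 x) (p2 x) \<partial>M)"
      by (intro nn_integral_cong nn_integral_multc) measurable
    also have "\<dots> \<le> (\<integral>\<^sup>+x. ennreal \<delta> * \<psi> (p1 x) (p2 x) \<partial>M)"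
      using kt_mass by (intro nn_integral_mono_AE) (auto elim!: eventually_mono intro!: mult_right_mono)
    also have "\<dots> = ennreal \<delta> * (\<integral>\<^sup>+x. \<psi> (p1 x) (p2 x) \<partial>M)"
      by (rule nn_integral_cmult) measurable
    finally show ?thesis .
  qed
qed

section \<open>Divergences in terms of densities\<close>

lemma entropy_function_diag:
  assumes "entropy_function \<Phi>" "0 \<le> a"
  shows "\<Phi> a a = 0"
proof -
  have "\<Phi> 1 1 = 0"
    using assms(1) unfolding entropy_function_def by (elim conjE)
  then show ?thesis
    using sublinear_scale[OF entropy_function_sublinear[OF assms(1)] assms(2), of 1 1] by simp
qed

text \<open>This reduces divergences to integrals of nonnegative functions.\<close>

lemma entropy_function_nonneg_shift:
  assumes \<Phi>: "entropy_function \<Phi>" and c: "\<forall>u\<ge>0. \<forall>v\<ge>0. ereal (c * (u - v)) \<le> \<Phi> u v"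
  shows "nonneg_entropy (\<lambda>u v. e2ennreal (\<Phi> u v - ereal (c * (u - v))))"
proof -
  note S = entropy_function_sublinear[OF \<Phi>]
  have nn: "0 \<le> \<Phi> u v - ereal (c * (u - v))" if "0 \<le> u" "0 \<le> v" for u v
    using c that by (simp add: ereal_diff_positive)
  have "sublinear (\<lambda>u v. enn2ereal (e2ennreal (\<Phi> u v - ereal (c * (u - v)))))"
    unfolding sublinear_def
  proof (intro conjI allI impI)
    fix u v :: real assume uv: "0 \<le> u" "0 \<le> v"
    show "enn2ereal (e2ennreal (\<Phi> u v - ereal (c * (u - v)))) \<noteq> - \<infinity>" by simp
    fix u' v' :: real assume uv': "0 \<le> u'" "0 \<le> v'"
    have "\<Phi> (u + u') (v + v') - ereal (c * ((u + u') - (v + v')))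
        \<le> (\<Phi> u v + \<Phi> u' v') - ereal (c * ((u + u') - (v + v')))"
      by (intro ereal_minus_mono sublinear_add[OF S] uv uv' order_refl)
    also have "\<dots> = (\<Phi> u v - ereal (c * (u - v))) + (\<Phi> u' v' - ereal (c * (u' - v')))"
      by (cases "\<Phi> u v"; cases "\<Phi> u' v'") (auto simp: algebra_simps)
    finally show "enn2ereal (e2ennreal (\<Phi> (u + u') (v + v') - ereal (c * ((u + u') - (v + v')))))
       \<le> enn2ereal (e2ennreal (\<Phi> u v - ereal (c * (u - v)))) +
         enn2ereal (e2ennreal (\<Phi> u' v' - ereal (c * (u' - v'))))"
      using uv uv' by (simp add: enn2ereal_e2ennreal nn)
  next
    fix a u v :: real assume auv: "0 \<le> a" "0 \<le> u" "0 \<le> v"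
    have "\<Phi> (a * u) (a * v) - ereal (c * (a * u - a * v)) = ereal a * \<Phi> u v - ereal (c * (a * u - a * v))"
      by (simp add: sublinear_scale[OF S auv])
    also have "\<dots> = ereal a * (\<Phi> u v - ereal (c * (u - v)))"
      using auv by (cases "\<Phi> u v"; cases "a = 0") (auto simp: algebra_simps)
    finally show "enn2ereal (e2ennreal (\<Phi> (a * u) (a * v) - ereal (c * (a * u - a * v))))
       = ereal a * enn2ereal (e2ennreal (\<Phi> u v - ereal (c * (u - v))))"
      using auv by (simp add: enn2ereal_e2ennreal nn)
  qed
  moreover have "e2ennreal (\<Phi> 1 1 - ereal (c * (1 - 1))) = 0"
    using entropy_function_diag[OF \<Phi>, of 1] by (simp add: e2ennreal_neg)
  ultimately show ?thesis by (simp add: nonneg_entropy_def)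
qed

lemma measure_plus_density:
  assumes [measurable]: "f \<in> borel_measurable L" "g \<in> borel_measurable L"
  shows "measure_plus (density L f) (density L g) = density L (\<lambda>x. f x + g x)"
proof -
  have "density L (\<lambda>x. f x + g x) = measure_of (space L) (sets L) (emeasure (density L (\<lambda>x. f x + g x)))"
    using measure_of_of_measure[of "density L (\<lambda>x. f x + g x)"] by simp
  also have "\<dots> = measure_plus (density L f) (density L g)"
    unfolding measure_plus_def space_density sets_density
    by (intro measure_of_eq sets.space_closed)
      (auto simp: sets.sigma_sets_eq emeasure_density nn_integral_add distrib_right)
  finally show ?thesis ..
qed

text \<open>Two probability densities with respect to a common base measure. The divergence refers to the
Radon-Nikodym derivatives with respect to the sum of the two measures, which are the shares \<open>s\<close>
and \<open>t\<close> of the densities in their sum; homogeneity then moves the integral to the base measure.\<close>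

locale density_pair = sigma_finite_measure L for L :: "'a measure" +
  fixes p q :: "'a \<Rightarrow> real"
  assumes p_meas [measurable]: "p \<in> borel_measurable L" and q_meas [measurable]: "q \<in> borel_measurable L"
    and p_nn: "\<And>x. 0 \<le> p x" and q_nn: "\<And>x. 0 \<le> q x"
    and p_int: "(\<integral>\<^sup>+x. ennreal (p x) \<partial>L) = 1" and q_int: "(\<integral>\<^sup>+x. ennreal (q x) \<partial>L) = 1"
begin

abbreviation "P \<equiv> density L (\<lambda>x. ennreal (p x))"
abbreviation "Q \<equiv> density L (\<lambda>x. ennreal (q x))"
definition "G = density L (\<lambda>x. ennreal (p x + q x))"
definition "s x = p x / (p x + q x)"
definition "t x = q x / (p x + q x)"

lemma st_measurable [measurable]: "s \<in> borel_measurable L" "t \<in> borel_measurable L"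
  unfolding s_def[abs_def] t_def[abs_def] by measurable

lemma st_nn: "0 \<le> s x" "0 \<le> t x"
  using p_nn q_nn by (auto simp: s_def t_def)

lemma st_scale: "(p x + q x) * s x = p x" "(p x + q x) * t x = q x"
  using p_nn[of x] q_nn[of x] by (auto simp: s_def t_def add_nonneg_eq_0_iff)

lemma st_scale_ennreal:
  "ennreal (p x + q x) * ennreal (s x) = ennreal (p x)"
  "ennreal (p x + q x) * ennreal (t x) = ennreal (q x)"
  using p_nn[of x] q_nn[of x] st_nn[of x] by (simp_all add: st_scale flip: ennreal_mult del: ennreal_plus)

lemma Phi_div_eq_ratio: "Phi_div \<Phi> P Q = ereal_integral G (\<lambda>x. \<Phi> (s x) (t x))"
proof -
  have G: "measure_plus P Q = G"
    using p_nn q_nn by (simp add: measure_plus_density G_def)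
  have emG: "emeasure G (space G) = 2"
    using p_nn q_nn by (simp add: G_def emeasure_density nn_integral_add p_int q_int cong: nn_integral_cong)
  interpret G: finite_measure G by standard (simp add: emG)
  have sP: "density G (\<lambda>x. ennreal (s x)) = P" and tQ: "density G (\<lambda>x. ennreal (t x)) = Q"
    unfolding G_def by (simp_all add: density_density_eq st_scale_ennreal del: ennreal_plus)
  have [measurable]: "s \<in> borel_measurable G" "t \<in> borel_measurable G"
    by (simp_all add: G_def)
  have "AE x in G. ennreal (s x) = RN_deriv G P x"
    by (intro G.RN_deriv_unique sP) measurable
  moreover have "AE x in G. ennreal (t x) = RN_deriv G Q x"
    by (intro G.RN_deriv_unique tQ) measurable
  ultimately have "AE x in G. \<Phi> (enn2real (RN_deriv G P x)) (enn2real (RN_deriv G Q x)) = \<Phi> (s x) (t x)"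
  proof eventually_elim
    case (elim x)
    then show ?case using st_nn[of x] by (metis enn2real_ennreal)
  qed
  then have "(\<integral>\<^sup>+x. e2ennreal (\<Phi> (enn2real (RN_deriv G P x)) (enn2real (RN_deriv G Q x))) \<partial>G)
        = (\<integral>\<^sup>+x. e2ennreal (\<Phi> (s x) (t x)) \<partial>G)"
      "(\<integral>\<^sup>+x. e2ennreal (- \<Phi> (enn2real (RN_deriv G P x)) (enn2real (RN_deriv G Q x))) \<partial>G)
        = (\<integral>\<^sup>+x. e2ennreal (- \<Phi> (s x) (t x)) \<partial>G)"
    by (auto intro!: nn_integral_cong_AE elim!: eventually_mono)
  then show ?thesis
    by (simp add: Phi_div_def ereal_integral_def G Let_def)
qed

lemma nn_integral_G:
  assumes [measurable]: "f \<in> borel_measurable L"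
  shows "(\<integral>\<^sup>+x. f x \<partial>G) = (\<integral>\<^sup>+x. ennreal (p x + q x) * f x \<partial>L)"
  unfolding G_def by (rule nn_integral_density) auto

text \<open>The integral of \<open>c * (p - q)\<close> vanishes. To see that subtracting it is harmless for the difference
of the integrals of positive and negative part, write it as \<open>gp - gm\<close> with nonnegative functions
of equal finite mass, and compare the two sides of
\<open>f\<^sup>+ + gm = f\<^sup>- + gp + \<psi>\<close>, an identity between nonnegative functions.\<close>

lemma Phi_div_eq_shifted:
  assumes \<Phi>: "entropy_function \<Phi>" and c: "\<forall>u\<ge>0. \<forall>v\<ge>0. ereal (c * (u - v)) \<le> \<Phi> u v"
  shows "Phi_div \<Phi> P Q = enn2ereal (\<integral>\<^sup>+x. e2ennreal (\<Phi> (p x) (q x) - ereal (c * (p x - q x))) \<partial>L)"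
proof -
  define \<psi> where "\<psi> u v = e2ennreal (\<Phi> u v - ereal (c * (u - v)))" for u v
  have \<psi>: "nonneg_entropy \<psi>"
    unfolding \<psi>_def[abs_def] by (rule entropy_function_nonneg_shift[OF \<Phi> c])
  have [measurable]: "(\<lambda>x. \<psi> (s x) (t x)) \<in> borel_measurable L"
    using st_nn by (intro nonneg_entropy_measurable[OF \<psi>]) auto
  define a where "a = max c 0"
  define b where "b = max (- c) 0"
  have ab: "0 \<le> a" "0 \<le> b" "c = a - b" by (auto simp: a_def b_def)
  define gp where "gp x = a * s x + b * t x" for x
  define gm where "gm x = a * t x + b * s x" for x
  have g_nn: "0 \<le> gp x" "0 \<le> gm x" for x
    using ab st_nn by (auto simp: gp_def gm_def)
  have g_int: "(\<integral>\<^sup>+x. ennreal (gp x) \<partial>G) = ennreal (a + b)" "(\<integral>\<^sup>+x. ennreal (gm x) \<partial>G) = ennreal (a + b)"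
  proof -
    have *: "(\<integral>\<^sup>+x. ennreal (\<alpha> * s x + \<beta> * t x) \<partial>G) = ennreal (\<alpha> + \<beta>)" if "0 \<le> \<alpha>" "0 \<le> \<beta>" for \<alpha> \<beta>
    proof -
      have "(\<integral>\<^sup>+x. ennreal (\<alpha> * s x + \<beta> * t x) \<partial>G) = (\<integral>\<^sup>+x. ennreal (p x + q x) * ennreal (\<alpha> * s x + \<beta> * t x) \<partial>L)"
        by (intro nn_integral_G) measurable
      also have "\<dots> = (\<integral>\<^sup>+x. ennreal \<alpha> * ennreal (p x) + ennreal \<beta> * ennreal (q x) \<partial>L)"
      proof (rule nn_integral_cong)
        fix x
        have "(p x + q x) * (\<alpha> * s x + \<beta> * t x) = \<alpha> * ((p x + q x) * s x) + \<beta> * ((p x + q x) * t x)"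
          by (simp add: algebra_simps)
        then have "(p x + q x) * (\<alpha> * s x + \<beta> * t x) = \<alpha> * p x + \<beta> * q x"
          by (simp only: st_scale)
        then show "ennreal (p x + q x) * ennreal (\<alpha> * s x + \<beta> * t x) = ennreal \<alpha> * ennreal (p x) + ennreal \<beta> * ennreal (q x)"
          using that p_nn q_nn st_nn by (simp flip: ennreal_mult ennreal_plus)
      qed
      also have "\<dots> = ennreal (\<alpha> + \<beta>)"
        using that by (simp add: nn_integral_add nn_integral_cmult p_int q_int)
      finally show ?thesis .
    qed
    show "(\<integral>\<^sup>+x. ennreal (gp x) \<partial>G) = ennreal (a + b)"
      unfolding gp_def using ab by (intro *)
    show "(\<integral>\<^sup>+x. ennreal (gm x) \<partial>G) = ennreal (a + b)"
      using *[of b a] ab by (simp add: gm_def add.commute)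
  qed
  define f where "f x = \<Phi> (s x) (t x)" for x
  have f_ge: "ereal (c * (s x - t x)) \<le> f x" for x
    using c st_nn by (simp add: f_def)
  have g_diff: "gp x - gm x = c * (s x - t x)" for x
    by (simp add: gp_def gm_def ab algebra_simps)
  have pt: "e2ennreal (f x) + ennreal (gm x) = e2ennreal (- f x) + ennreal (gp x) + \<psi> (s x) (t x)" for x
  proof (cases "f x")
    case (real r)
    have r: "gp x - gm x \<le> r" using f_ge[of x] real g_diff[of x] by simp
    have "\<psi> (s x) (t x) = ennreal (r - (gp x - gm x))"
      using real by (simp add: \<psi>_def f_def g_diff)
    then show ?thesis
      using real r g_nn[of x] by (cases "0 \<le> r") (simp_all add: ennreal_neg flip: ennreal_plus)
  next
    case PInf
    then show ?thesis by (simp add: \<psi>_def f_def)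
  next
    case MInf
    then show ?thesis using f_ge[of x] by simp
  qed
  have f_meas [measurable]: "f \<in> borel_measurable L"
  proof -
    have "f = (\<lambda>x. enn2ereal (\<psi> (s x) (t x)) + ereal (c * (s x - t x)))"
    proof
      fix x
      show "f x = enn2ereal (\<psi> (s x) (t x)) + ereal (c * (s x - t x))"
        using f_ge[of x] by (cases "f x") (auto simp: \<psi>_def f_def[symmetric])
    qed
    also have "\<dots> \<in> borel_measurable L" by measurable
    finally show ?thesis .
  qed
  have [measurable]: "f \<in> borel_measurable G" "gp \<in> borel_measurable G" "gm \<in> borel_measurable G"
      "(\<lambda>x. \<psi> (s x) (t x)) \<in> borel_measurable G"
    by (simp_all add: G_def gp_def[abs_def] gm_def[abs_def])
  let ?fp = "\<integral>\<^sup>+x. e2ennreal (f x) \<partial>G" and ?fm = "\<integral>\<^sup>+x. e2ennreal (- f x) \<partial>G"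
  have fm_fin: "?fm < \<top>"
  proof -
    have "?fm \<le> (\<integral>\<^sup>+x. ennreal (gm x) \<partial>G)"
    proof (rule nn_integral_mono)
      fix x
      have "- f x \<le> ereal (gm x)"
        using f_ge[of x] g_diff[of x] g_nn[of x] by (cases "f x") auto
      then show "e2ennreal (- f x) \<le> ennreal (gm x)" by (metis e2ennreal_mono e2ennreal_ereal)
    qed
    then show ?thesis unfolding g_int by (simp add: order_le_less_trans)
  qed
  have "?fp + ennreal (a + b) = ?fm + ennreal (a + b) + (\<integral>\<^sup>+x. \<psi> (s x) (t x) \<partial>G)"
  proof -
    have "?fp + ennreal (a + b) = (\<integral>\<^sup>+x. e2ennreal (f x) + ennreal (gm x) \<partial>G)"
      by (subst nn_integral_add) (auto simp: g_int)
    also have "\<dots> = ?fm + ennreal (a + b) + (\<integral>\<^sup>+x. \<psi> (s x) (t x) \<partial>G)"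
      unfolding pt by (subst nn_integral_add nn_integral_add | simp add: g_int)+
    finally show ?thesis .
  qed
  then have "ennreal (a + b) + ?fp = ennreal (a + b) + (?fm + (\<integral>\<^sup>+x. \<psi> (s x) (t x) \<partial>G))"
    by (simp add: ac_simps)
  then have fp: "?fp = ?fm + (\<integral>\<^sup>+x. \<psi> (s x) (t x) \<partial>G)"
    by (simp add: ennreal_add_left_cancel)
  have "(\<integral>\<^sup>+x. \<psi> (s x) (t x) \<partial>G) = (\<integral>\<^sup>+x. ennreal (p x + q x) * \<psi> (s x) (t x) \<partial>L)"
    by (intro nn_integral_G) measurable
  also have "\<dots> = (\<integral>\<^sup>+x. \<psi> (p x) (q x) \<partial>L)"
  proof (rule nn_integral_cong)
    fix x
    show "ennreal (p x + q x) * \<psi> (s x) (t x) = \<psi> (p x) (q x)"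
      using nonneg_entropy_scale[OF \<psi>, of "p x + q x" "s x" "t x"] st_nn p_nn q_nn by (simp add: st_scale)
  qed
  finally have psi: "(\<integral>\<^sup>+x. \<psi> (s x) (t x) \<partial>G) = (\<integral>\<^sup>+x. \<psi> (p x) (q x) \<partial>L)" .
  have "Phi_div \<Phi> P Q = enn2ereal ?fp - enn2ereal ?fm"
    by (simp add: Phi_div_eq_ratio ereal_integral_def f_def)
  also have "\<dots> = enn2ereal (\<integral>\<^sup>+x. \<psi> (p x) (q x) \<partial>L)"
    unfolding fp psi plus_ennreal.rep_eq
    using fm_fin by (cases ?fm; cases "\<integral>\<^sup>+x. \<psi> (p x) (q x) \<partial>L") auto
  finally show ?thesis by (simp add: \<psi>_def)
qed

lemma Phi_div_eq_0:
  assumes \<Phi>: "entropy_function \<Phi>" and eq: "AE x in L. p x = q x"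
  shows "Phi_div \<Phi> P Q = 0"
proof -
  have "AE x in G. \<Phi> (s x) (t x) = 0"
    unfolding G_def
  proof (subst AE_density, measurable, use eq in eventually_elim)
    case (elim x)
    then have "t x = s x" by (simp add: s_def t_def)
    then show ?case using entropy_function_diag[OF \<Phi> st_nn(1)[of x]] by simp
  qed
  then have "(\<integral>\<^sup>+x. e2ennreal (\<Phi> (s x) (t x)) \<partial>G) = (\<integral>\<^sup>+x. 0 \<partial>G)"
    "(\<integral>\<^sup>+x. e2ennreal (- \<Phi> (s x) (t x)) \<partial>G) = (\<integral>\<^sup>+x. 0 \<partial>G)"
    by (intro nn_integral_cong_AE; auto elim!: eventually_mono simp: e2ennreal_neg)+
  then show ?thesis
    by (simp add: Phi_div_eq_ratio ereal_integral_def)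
qed

lemma not_AE_eq_imp_not_AE_le:
  assumes "\<not> (AE x in L. p x = q x)"
  shows "\<not> (AE x in L. p x \<le> q x)" "\<not> (AE x in L. q x \<le> p x)"
proof -
  have int: "integrable L p" "integrable L q"
    using p_nn q_nn p_int q_int by (auto intro!: integrableI_nonneg)
  have "(\<integral>x. p x \<partial>L) = 1" "(\<integral>x. q x \<partial>L) = 1"
    using p_nn q_nn p_int q_int by (auto simp: integral_eq_nn_integral)
  then have "(\<integral>x. q x - p x \<partial>L) = 0" "(\<integral>x. p x - q x \<partial>L) = 0"
    using int by simp_all
  note zero = this
  show "\<not> (AE x in L. p x \<le> q x)"
  proof
    assume "AE x in L. p x \<le> q x"
    then have "AE x in L. q x - p x = 0"
      using int zero(1) by (subst integral_nonneg_eq_0_iff_AE[symmetric]) auto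
    then have "AE x in L. p x = q x" by eventually_elim simp
    then show False using assms by simp
  qed
  show "\<not> (AE x in L. q x \<le> p x)"
  proof
    assume "AE x in L. q x \<le> p x"
    then have "AE x in L. p x - q x = 0"
      using int zero(2) by (subst integral_nonneg_eq_0_iff_AE[symmetric]) auto
    then show False using assms by auto
  qed
qed

text \<open>Distinct probability densities exceed each other on sets of positive measure, and on one of
these sets the integrand is infinite. Whatever the integral of the negative part is, the
divergence is then infinite, because \<open>\<infinity> - \<infinity> = \<infinity>\<close> in \<^typ>\<open>ereal\<close>.\<close>

lemma Phi_div_eq_infinity:
  assumes \<Phi>: "(\<forall>u\<ge>0. \<forall>v\<ge>0. v < u \<longrightarrow> \<Phi> u v = \<infinity>) \<or> (\<forall>u\<ge>0. \<forall>v\<ge>0. u < v \<longrightarrow> \<Phi> u v = \<infinity>)"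
    and neq: "\<not> (AE x in L. p x = q x)"
  shows "Phi_div \<Phi> P Q = \<infinity>"
proof -
  have *: "(\<integral>\<^sup>+x. e2ennreal (\<Phi> (s x) (t x)) \<partial>G) = \<infinity>"
    if A: "\<And>x. x \<in> A \<Longrightarrow> 0 < p x + q x \<and> \<Phi> (s x) (t x) = \<infinity>" "\<not> (AE x in L. x \<notin> A)" "A \<in> sets L" for A
  proof -
    have "\<not> (AE x in G. x \<notin> A)"
    proof
      assume "AE x in G. x \<notin> A"
      then have "AE x in L. 0 < ennreal (p x + q x) \<longrightarrow> x \<notin> A"
        unfolding G_def by (subst (asm) AE_density) auto
      then have "AE x in L. x \<notin> A"
        by eventually_elim (use A(1) in auto)
      then show False using A(2) by simp
    qed
    then have "emeasure G A \<noteq> 0"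
      using AE_iff_measurable[of A G "\<lambda>x. x \<notin> A"] A(3) sets.sets_into_space[OF A(3)] by (auto simp: G_def)
    then have "(\<integral>\<^sup>+x. \<infinity> * indicator A x \<partial>G) = \<infinity>"
      using A(3) by (subst nn_integral_cmult_indicator) (auto simp: G_def ennreal_top_mult)
    moreover have "(\<integral>\<^sup>+x. \<infinity> * indicator A x \<partial>G) \<le> (\<integral>\<^sup>+x. e2ennreal (\<Phi> (s x) (t x)) \<partial>G)"
      using A(1) by (intro nn_integral_mono) (auto simp: indicator_def)
    ultimately show ?thesis by (simp add: top_unique)
  qed
  from \<Phi> have "(\<integral>\<^sup>+x. e2ennreal (\<Phi> (s x) (t x)) \<partial>G) = \<infinity>"
  proof
    assume \<Phi>: "\<forall>u\<ge>0. \<forall>v\<ge>0. v < u \<longrightarrow> \<Phi> u v = \<infinity>"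
    show ?thesis
    proof (rule *[of "{x \<in> space L. q x < p x}"])
      show "\<not> (AE x in L. x \<notin> {x \<in> space L. q x < p x})"
        using not_AE_eq_imp_not_AE_le(1)[OF neq] by (simp add: not_less cong: AE_cong_simp)
      fix x assume x: "x \<in> {x \<in> space L. q x < p x}"
      then have pos: "0 < p x + q x" using p_nn[of x] q_nn[of x] by auto
      moreover have "t x < s x" using x pos by (simp add: s_def t_def divide_strict_right_mono)
      ultimately show "0 < p x + q x \<and> \<Phi> (s x) (t x) = \<infinity>" using \<Phi> st_nn by simp
    qed measurable
  next
    assume \<Phi>: "\<forall>u\<ge>0. \<forall>v\<ge>0. u < v \<longrightarrow> \<Phi> u v = \<infinity>"
    show ?thesis
    proof (rule *[of "{x \<in> space L. p x < q x}"])
      show "\<not> (AE x in L. x \<notin> {x \<in> space L. p x < q x})"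
        using not_AE_eq_imp_not_AE_le(2)[OF neq] by (simp add: not_less cong: AE_cong_simp)
      fix x assume x: "x \<in> {x \<in> space L. p x < q x}"
      then have pos: "0 < p x + q x" using p_nn[of x] q_nn[of x] by auto
      moreover have "s x < t x" using x pos by (simp add: s_def t_def divide_strict_right_mono)
      ultimately show "0 < p x + q x \<and> \<Phi> (s x) (t x) = \<infinity>" using \<Phi> st_nn by simp
    qed measurable
  qed
  then show ?thesis by (simp add: Phi_div_eq_ratio ereal_integral_def)
qed

lemma Phi_div_nonneg:
  assumes "entropy_function \<Phi>"
  shows "0 \<le> Phi_div \<Phi> P Q"
  using entropy_function_trichotomy[OF assms]
proof
  assume "\<exists>c. \<forall>u\<ge>0. \<forall>v\<ge>0. ereal (c * (u - v)) \<le> \<Phi> u v"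
  then show ?thesis using Phi_div_eq_shifted[OF assms] by auto
next
  assume *: "(\<forall>u\<ge>0. \<forall>v\<ge>0. v < u \<longrightarrow> \<Phi> u v = \<infinity>) \<or> (\<forall>u\<ge>0. \<forall>v\<ge>0. u < v \<longrightarrow> \<Phi> u v = \<infinity>)"
  show ?thesis
    using Phi_div_eq_infinity[OF *] Phi_div_eq_0[OF assms] by (cases "AE x in L. p x = q x") auto
qed

end

lemma nonneg_entropy_abs_diff: "nonneg_entropy (\<lambda>u v. ennreal \<bar>u - v\<bar>)"
  unfolding nonneg_entropy_def sublinear_def
  by (auto simp flip: right_diff_distrib simp: abs_mult)

text \<open>If \<open>\<Phi>\<close> has no linear minorant, the right-hand side is infinite unless \<open>\<delta> = 0\<close> or the two densities
agree. In both exceptional cases the images agree: apply the contraction to \<open>\<bar>u - v\<bar>\<close>.\<close>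

lemma Phi_div_kernel_contraction:
  fixes p1 p2 :: "'a \<Rightarrow> real" and k :: "'a \<Rightarrow> 'b \<Rightarrow> real"
  assumes \<Phi>: "entropy_function \<Phi>"
    and M: "sigma_finite_measure M" and N: "sigma_finite_measure N"
    and p_meas [measurable]: "p1 \<in> borel_measurable M" "p2 \<in> borel_measurable M"
    and p_nn: "\<And>x. 0 \<le> p1 x" "\<And>x. 0 \<le> p2 x"
    and p_int: "(\<integral>\<^sup>+x. ennreal (p1 x) \<partial>M) = 1" "(\<integral>\<^sup>+x. ennreal (p2 x) \<partial>M) = 1"
    and k_meas: "(\<lambda>(x, y). k x y) \<in> borel_measurable (M \<Otimes>\<^sub>M N)"
    and k_nn: "\<And>x y. 0 \<le> k x y"
    and k_int: "AE x in M. (\<integral>\<^sup>+y. ennreal (k x y) \<partial>N) = 1"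
    and \<delta>: "0 \<le> \<delta>" "\<delta> \<le> 1"
    and overlap: "AE x in M. AE z in M. ennreal (1 - \<delta>) \<le> (\<integral>\<^sup>+y. ennreal (min (k x y) (k z y)) \<partial>N)"
  defines "g1 \<equiv> \<lambda>y. \<integral>\<^sup>+x. ennreal (p1 x * k x y) \<partial>M"
    and "g2 \<equiv> \<lambda>y. \<integral>\<^sup>+x. ennreal (p2 x * k x y) \<partial>M"
  shows "Phi_div \<Phi> (density N g1) (density N g2)
     \<le> ereal \<delta> * Phi_div \<Phi> (density M (\<lambda>x. ennreal (p1 x))) (density M (\<lambda>x. ennreal (p2 x)))"
proof -
  have d1: "g1 \<in> borel_measurable N" "AE y in N. ennreal (enn2real (g1 y)) = g1 y"
      "(\<integral>\<^sup>+y. ennreal (enn2real (g1 y)) \<partial>N) = 1"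
    unfolding g1_def by (rule kernel_push_density[OF M N p_meas(1) p_nn(1) p_int(1) k_meas k_nn k_int])+
  have d2: "g2 \<in> borel_measurable N" "AE y in N. ennreal (enn2real (g2 y)) = g2 y"
      "(\<integral>\<^sup>+y. ennreal (enn2real (g2 y)) \<partial>N) = 1"
    unfolding g2_def by (rule kernel_push_density[OF M N p_meas(2) p_nn(2) p_int(2) k_meas k_nn k_int])+
  note [measurable] = d1(1) d2(1)
  interpret M: sigma_finite_measure M by fact
  interpret N: sigma_finite_measure N by fact
  interpret p: density_pair M p1 p2
    by standard (use p_nn p_int in auto)
  interpret g: density_pair N "\<lambda>y. enn2real (g1 y)" "\<lambda>y. enn2real (g2 y)"
    by standard (use d1 d2 in auto)
  have dens: "density N g1 = density N (\<lambda>y. ennreal (enn2real (g1 y)))"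
      "density N g2 = density N (\<lambda>y. ennreal (enn2real (g2 y)))"
    using d1(2) d2(2) by (auto intro!: density_cong simp: eq_commute)
  have contract: "(\<integral>\<^sup>+y. \<psi> (enn2real (g1 y)) (enn2real (g2 y)) \<partial>N) \<le> ennreal \<delta> * (\<integral>\<^sup>+x. \<psi> (p1 x) (p2 x) \<partial>M)"
    if "nonneg_entropy \<psi>" for \<psi>
    unfolding g1_def g2_def
    by (rule nonneg_entropy_kernel_contraction[OF that M N p_meas p_nn p_int k_meas k_nn k_int \<delta> overlap])
  from entropy_function_trichotomy[OF \<Phi>] show ?thesis
  proof
    assume "\<exists>c. \<forall>u\<ge>0. \<forall>v\<ge>0. ereal (c * (u - v)) \<le> \<Phi> u v"
    then obtain c where c: "\<forall>u\<ge>0. \<forall>v\<ge>0. ereal (c * (u - v)) \<le> \<Phi> u v" ..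
    have "enn2ereal (\<integral>\<^sup>+y. e2ennreal (\<Phi> (enn2real (g1 y)) (enn2real (g2 y)) - ereal (c * (enn2real (g1 y) - enn2real (g2 y)))) \<partial>N)
      \<le> enn2ereal (ennreal \<delta> * (\<integral>\<^sup>+x. e2ennreal (\<Phi> (p1 x) (p2 x) - ereal (c * (p1 x - p2 x))) \<partial>M))"
      using contract[OF entropy_function_nonneg_shift[OF \<Phi> c]] by (simp add: less_eq_ennreal.rep_eq)
    then show ?thesis
      unfolding dens p.Phi_div_eq_shifted[OF \<Phi> c] g.Phi_div_eq_shifted[OF \<Phi> c]
      using \<delta> by (simp add: times_ennreal.rep_eq)
  next
    assume inf: "(\<forall>u\<ge>0. \<forall>v\<ge>0. v < u \<longrightarrow> \<Phi> u v = \<infinity>) \<or> (\<forall>u\<ge>0. \<forall>v\<ge>0. u < v \<longrightarrow> \<Phi> u v = \<infinity>)"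
    show ?thesis
    proof (cases "\<delta> = 0 \<or> (AE x in M. p1 x = p2 x)")
      case True
      then have "ennreal \<delta> * (\<integral>\<^sup>+x. ennreal \<bar>p1 x - p2 x\<bar> \<partial>M) = 0"
      proof
        assume "AE x in M. p1 x = p2 x"
        then have "(\<integral>\<^sup>+x. ennreal \<bar>p1 x - p2 x\<bar> \<partial>M) = (\<integral>\<^sup>+x. 0 \<partial>M)"
          by (intro nn_integral_cong_AE) (auto elim!: eventually_mono)
        then show ?thesis by simp
      qed simp
      then have "(\<integral>\<^sup>+y. ennreal \<bar>enn2real (g1 y) - enn2real (g2 y)\<bar> \<partial>N) \<le> 0"
        using contract[OF nonneg_entropy_abs_diff] by (rule subst)
      then have "(\<integral>\<^sup>+y. ennreal \<bar>enn2real (g1 y) - enn2real (g2 y)\<bar> \<partial>N) = 0"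
        by simp
      then have "AE y in N. enn2real (g1 y) = enn2real (g2 y)"
        by (subst (asm) nn_integral_0_iff_AE) (auto elim!: eventually_mono)
      then show ?thesis
        unfolding dens using p.Phi_div_nonneg[OF \<Phi>] \<delta> by (simp add: g.Phi_div_eq_0[OF \<Phi>])
    next
      case False
      then show ?thesis
        using \<delta> by (simp add: p.Phi_div_eq_infinity[OF inf])
    qed
  qed
qed

lemma entropy_function_tv: "entropy_function (\<lambda>u v. ereal \<bar>u - v\<bar>)"
  unfolding entropy_function_def
proof (intro conjI allI impI ballI)
  fix u v u' v' t :: real assume t: "t \<in> {0..1}"
  have "(1 - t) * u + t * u' - ((1 - t) * v + t * v') = (1 - t) * (u - v) + t * (u' - v')"
    by (simp add: algebra_simps)
  then have "\<bar>(1 - t) * u + t * u' - ((1 - t) * v + t * v')\<bar> \<le> \<bar>(1 - t) * (u - v)\<bar> + \<bar>t * (u' - v')\<bar>"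
    by (metis abs_triangle_ineq)
  then show "ereal \<bar>(1 - t) * u + t * u' - ((1 - t) * v + t * v')\<bar>
      \<le> ereal (1 - t) * ereal \<bar>u - v\<bar> + ereal t * ereal \<bar>u' - v'\<bar>"
    using t by (simp add: abs_mult)
next
  fix a u v :: real assume "0 \<le> a"
  then show "ereal \<bar>a * u - a * v\<bar> = ereal a * ereal \<bar>u - v\<bar>"
    by (simp add: abs_mult flip: right_diff_distrib)
qed auto

lemma (in density_pair) Phi_div_tv:
  "integrable L (\<lambda>x. \<bar>p x - q x\<bar>)"
  "Phi_div (\<lambda>u v. ereal \<bar>u - v\<bar>) P Q = ereal (\<integral>x. \<bar>p x - q x\<bar> \<partial>L)"
  "(\<integral>x. \<bar>p x - q x\<bar> \<partial>L) \<le> 2"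
proof -
  have int: "integrable L p" "integrable L q"
    using p_nn q_nn p_int q_int by (auto intro!: integrableI_nonneg)
  then show *: "integrable L (\<lambda>x. \<bar>p x - q x\<bar>)" by simp
  have "Phi_div (\<lambda>u v. ereal \<bar>u - v\<bar>) P Q = enn2ereal (\<integral>\<^sup>+x. ennreal \<bar>p x - q x\<bar> \<partial>L)"
    using Phi_div_eq_shifted[OF entropy_function_tv, of 0] by simp
  also have "(\<integral>\<^sup>+x. ennreal \<bar>p x - q x\<bar> \<partial>L) = ennreal (\<integral>x. \<bar>p x - q x\<bar> \<partial>L)"
    using * by (intro nn_integral_eq_integral) auto
  finally show "Phi_div (\<lambda>u v. ereal \<bar>u - v\<bar>) P Q = ereal (\<integral>x. \<bar>p x - q x\<bar> \<partial>L)"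
    by simp
  have "(\<integral>x. \<bar>p x - q x\<bar> \<partial>L) \<le> (\<integral>x. p x + q x \<partial>L)"
    using * int p_nn q_nn by (intro integral_mono) (auto simp: abs_le_iff intro: add_increasing add_increasing2)
  also have "\<dots> = 2"
    using int p_nn q_nn p_int q_int by (simp add: integral_eq_nn_integral)
  finally show "(\<integral>x. \<bar>p x - q x\<bar> \<partial>L) \<le> 2" .
qed

section \<open>Total variation distance and the Dobrushin coefficient\<close>

lemma sum_partition_diff_le:
  assumes M: "subprob_space M" and N: "subprob_space N" and sets: "sets N = sets M" and c: "0 \<le> c"
    and le: "\<And>A. A \<in> sets M \<Longrightarrow> \<bar>measure M A - measure N A\<bar> \<le> c * (measure M A + measure N A)"
    and P: "finite P" "partition_on (space M) P" "P \<subseteq> sets M"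
  shows "(\<Sum>A\<in>P. \<bar>measure M A - measure N A\<bar>) \<le> 2 * c"
proof -
  have mass: "(\<Sum>A\<in>P. measure K A) \<le> 1" if K: "subprob_space K" "sets K = sets M" for K
  proof -
    interpret K: subprob_space K by fact
    have "disjoint_family_on (\<lambda>A. A) P"
      using P(2) by (auto simp: partition_on_def disjoint_def disjoint_family_on_def)
    then have "(\<Sum>A\<in>P. measure K A) = measure K (\<Union>A\<in>P. A)"
      using P K by (intro K.finite_measure_finite_Union[symmetric]) auto
    also have "\<dots> \<le> 1" by (rule K.subprob_measure_le_1)
    finally show ?thesis .
  qed
  have "(\<Sum>A\<in>P. \<bar>measure M A - measure N A\<bar>) \<le> (\<Sum>A\<in>P. c * (measure M A + measure N A))"
    using P by (intro sum_mono le) auto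
  also have "\<dots> = c * ((\<Sum>A\<in>P. measure M A) + (\<Sum>A\<in>P. measure N A))"
    by (simp add: sum.distrib flip: sum_distrib_left)
  also have "\<dots> \<le> c * 2"
    using mass[OF M refl] mass[OF N sets] c by (intro mult_left_mono) auto
  finally show ?thesis by simp
qed

lemma abs_measure_diff_le: "\<bar>measure M A - measure N A\<bar> \<le> 1 * (measure M A + measure N A)"
  by (auto simp: abs_le_iff intro: add_increasing add_increasing2)

lemma partition_on_complement:
  "A \<subseteq> S \<Longrightarrow> partition_on S ({A, S - A} - {{}})"
  by (auto simp: partition_on_def disjoint_def)

lemma tv_dist_le:
  assumes "subprob_space M" "subprob_space N" "sets N = sets M" "0 \<le> c"
    and "\<And>A. A \<in> sets M \<Longrightarrow> \<bar>measure M A - measure N A\<bar> \<le> c * (measure M A + measure N A)"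
  shows "tv_dist M N \<le> c"
proof -
  have "(SUP P \<in> {P. finite P \<and> partition_on (space M) P \<and> P \<subseteq> sets M}.
       \<Sum>A\<in>P. \<bar>measure M A - measure N A\<bar>) \<le> 2 * c"
  proof (rule cSUP_least)
    show "{P. finite P \<and> partition_on (space M) P \<and> P \<subseteq> sets M} \<noteq> {}"
      using partition_on_complement[of "space M" "space M"]
      by (auto intro!: exI[of _ "{space M, space M - space M} - {{}}"])
  qed (use sum_partition_diff_le[OF assms] in auto)
  then show ?thesis by (simp add: tv_dist_def)
qed

lemma tv_dist_le_1:
  assumes "subprob_space M" "subprob_space N" "sets N = sets M"
  shows "tv_dist M N \<le> 1"
  by (rule tv_dist_le[OF assms zero_le_one abs_measure_diff_le])

lemma tv_dist_ge_set:
  assumes M: "subprob_space M" and N: "subprob_space N" and sets: "sets N = sets M"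
    and A: "A \<in> sets M"
  shows "\<bar>measure M A - measure N A\<bar> + \<bar>measure M (space M - A) - measure N (space M - A)\<bar>
     \<le> 2 * tv_dist M N"
proof -
  let ?f = "\<lambda>A. \<bar>measure M A - measure N A\<bar>"
  (* partitions have nonempty blocks *)
  let ?P = "{A, space M - A} - {{}}"
  have "?f A + ?f (space M - A) = (\<Sum>B\<in>{A, space M - A}. ?f B)"
  proof (cases "A = space M - A")
    case True
    then have "A = {}" by auto
    then show ?thesis using True by simp
  qed simp
  also have "\<dots> = (\<Sum>B\<in>?P. ?f B)"
    by (intro sum.mono_neutral_right) auto
  also have "\<dots> \<le> (SUP P \<in> {P. finite P \<and> partition_on (space M) P \<and> P \<subseteq> sets M}. \<Sum>A\<in>P. ?f A)"
  proof (rule cSUP_upper)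
    show "?P \<in> {P. finite P \<and> partition_on (space M) P \<and> P \<subseteq> sets M}"
      using partition_on_complement[OF sets.sets_into_space[OF A]] A by auto
    show "bdd_above ((\<lambda>P. \<Sum>A\<in>P. ?f A) ` {P. finite P \<and> partition_on (space M) P \<and> P \<subseteq> sets M})"
      using sum_partition_diff_le[OF M N sets zero_le_one abs_measure_diff_le]
      by (intro bdd_aboveI[of _ "2 * 1"]) auto
  qed
  finally show ?thesis by (simp add: tv_dist_def)
qed

text \<open>The partition into \<open>{k2 < k1}\<close> and its complement realises the total variation distance.\<close>

lemma tv_dist_overlap:
  fixes k1 k2 :: "'b \<Rightarrow> real"
  assumes [measurable]: "k1 \<in> borel_measurable N" "k2 \<in> borel_measurable N"
    and nn: "\<And>y. 0 \<le> k1 y" "\<And>y. 0 \<le> k2 y"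
    and int: "(\<integral>\<^sup>+y. ennreal (k1 y) \<partial>N) = 1" "(\<integral>\<^sup>+y. ennreal (k2 y) \<partial>N) = 1"
  shows "ennreal (1 - tv_dist (density N k1) (density N k2)) \<le> (\<integral>\<^sup>+y. ennreal (min (k1 y) (k2 y)) \<partial>N)"
proof -
  let ?K1 = "density N (\<lambda>y. ennreal (k1 y))" and ?K2 = "density N (\<lambda>y. ennreal (k2 y))"
  define A where "A = {y \<in> space N. k2 y < k1 y}"
  have [measurable]: "A \<in> sets N" by (simp add: A_def)
  interpret K1: prob_space ?K1 by standard (simp add: emeasure_density int cong: nn_integral_cong)
  interpret K2: prob_space ?K2 by standard (simp add: emeasure_density int cong: nn_integral_cong)
  have "\<bar>measure ?K1 A - measure ?K2 A\<bar> + \<bar>measure ?K1 (space N - A) - measure ?K2 (space N - A)\<bar>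
      \<le> 2 * tv_dist ?K1 ?K2"
    using tv_dist_ge_set[of ?K1 ?K2 A] K1.subprob_space_axioms K2.subprob_space_axioms by simp
  moreover have "measure ?K1 (space N - A) = 1 - measure ?K1 A" "measure ?K2 (space N - A) = 1 - measure ?K2 A"
    using K1.prob_compl[of A] K2.prob_compl[of A] by auto
  ultimately have "1 - tv_dist ?K1 ?K2 \<le> measure ?K1 (space N - A) + measure ?K2 A"
    by linarith
  then have "ennreal (1 - tv_dist ?K1 ?K2) \<le> ennreal (measure ?K1 (space N - A) + measure ?K2 A)"
    by (rule ennreal_leI)
  also have "\<dots> = emeasure ?K1 (space N - A) + emeasure ?K2 A"
    by (simp add: K1.emeasure_eq_measure K2.emeasure_eq_measure)
  also have "\<dots> = (\<integral>\<^sup>+y. ennreal (k1 y) * indicator (space N - A) y + ennreal (k2 y) * indicator A y \<partial>N)"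
    by (simp add: emeasure_density nn_integral_add)
  also have "\<dots> = (\<integral>\<^sup>+y. ennreal (min (k1 y) (k2 y)) \<partial>N)"
    by (intro nn_integral_cong) (auto simp: A_def indicator_def min_def)
  finally show ?thesis .
qed

lemma tv_dist_le_dobrushin:
  assumes "\<And>x. subprob_space (K x)" "\<And>x. sets (K x) = sets N"
  shows "tv_dist (K x) (K z) \<le> dobrushin K"
proof -
  have "bdd_above (range (\<lambda>(x1, x2). tv_dist (K x1) (K x2)))"
    using assms by (intro bdd_aboveI[of _ 1]) (auto intro!: tv_dist_le_1)
  then show ?thesis
    unfolding dobrushin_def using cSUP_upper[of "(x, z)" UNIV "\<lambda>(x1, x2). tv_dist (K x1) (K x2)"] by simp
qed

lemma dobrushin_bounds:
  assumes K: "\<And>x. subprob_space (K x)" "\<And>x. sets (K x) = sets N"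
  shows "0 \<le> dobrushin K" "dobrushin K \<le> 1"
proof -
  have "0 \<le> tv_dist (K undefined) (K undefined)"
    using tv_dist_ge_set[OF K(1) K(1) refl sets.empty_sets, of undefined] by simp
  also have "\<dots> \<le> dobrushin K" by (rule tv_dist_le_dobrushin[OF K])
  finally show "0 \<le> dobrushin K" .
  show "dobrushin K \<le> 1"
    unfolding dobrushin_def using K by (intro cSUP_least) (auto intro!: tv_dist_le_1)
qed

text \<open>On every set the smaller of the two masses is at least \<open>\<kappa>\<close> times the larger one, hence the
difference is at most \<open>1 - \<kappa>\<close> times the sum.\<close>

lemma tv_dist_density_ratio_le:
  fixes k1 k2 :: "'b \<Rightarrow> real"
  assumes [measurable]: "k1 \<in> borel_measurable N" "k2 \<in> borel_measurable N"
    and nn: "\<And>y. 0 \<le> k1 y" "\<And>y. 0 \<le> k2 y"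
    and int: "(\<integral>\<^sup>+y. ennreal (k1 y) \<partial>N) = 1" "(\<integral>\<^sup>+y. ennreal (k2 y) \<partial>N) = 1"
    and \<kappa>: "0 < \<kappa>" "\<kappa> \<le> 1" and ratio: "\<And>y. \<kappa> * k2 y \<le> k1 y" "\<And>y. \<kappa> * k1 y \<le> k2 y"
  shows "tv_dist (density N k1) (density N k2) \<le> 1 - \<kappa>"
proof -
  interpret K1: prob_space "density N k1" by standard (simp add: emeasure_density int cong: nn_integral_cong)
  interpret K2: prob_space "density N k2" by standard (simp add: emeasure_density int cong: nn_integral_cong)
  have ratio_m: "\<kappa> * measure (density N g) A \<le> measure (density N f) A"
    if [measurable]: "A \<in> sets N" "f \<in> borel_measurable N" "g \<in> borel_measurable N"
      and le: "\<And>y. \<kappa> * g y \<le> f y" and nn: "\<And>y. 0 \<le> g y"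
      and fin: "finite_measure (density N f)" "finite_measure (density N g)" for A f g
  proof -
    interpret f: finite_measure "density N f" by fact
    interpret g: finite_measure "density N g" by fact
    have "ennreal (\<kappa> * measure (density N g) A) = ennreal \<kappa> * emeasure (density N g) A"
      using \<kappa> by (simp add: g.emeasure_eq_measure ennreal_mult)
    also have "\<dots> = (\<integral>\<^sup>+y. ennreal \<kappa> * (ennreal (g y) * indicator A y) \<partial>N)"
      by (simp add: emeasure_density nn_integral_cmult)
    also have "\<dots> \<le> (\<integral>\<^sup>+y. ennreal (f y) * indicator A y \<partial>N)"
      using le nn \<kappa> by (intro nn_integral_mono) (auto simp: indicator_def simp flip: ennreal_mult intro!: ennreal_leI)
    also have "\<dots> = ennreal (measure (density N f) A)"
      by (simp add: emeasure_density flip: f.emeasure_eq_measure)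
    finally show ?thesis by simp
  qed
  show ?thesis
  proof (rule tv_dist_le)
    fix A assume "A \<in> sets (density N k1)"
    then have A: "A \<in> sets N" by simp
    have 1: "\<kappa> * measure (density N k2) A \<le> measure (density N k1) A"
      by (rule ratio_m[OF A _ _ ratio(1) nn(2)]) (auto intro: K1.finite_measure_axioms K2.finite_measure_axioms)
    have 2: "\<kappa> * measure (density N k1) A \<le> measure (density N k2) A"
      by (rule ratio_m[OF A _ _ ratio(2) nn(1)]) (auto intro: K1.finite_measure_axioms K2.finite_measure_axioms)
    have 3: "\<kappa> * measure (density N k1) A \<le> measure (density N k1) A"
        "\<kappa> * measure (density N k2) A \<le> measure (density N k2) A"
      using \<kappa> by (auto intro!: mult_left_le_one_le)
    show "\<bar>measure (density N k1) A - measure (density N k2) A\<bar>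
        \<le> (1 - \<kappa>) * (measure (density N k1) A + measure (density N k2) A)"
      using 1 2 3 by (simp add: abs_if algebra_simps)
  qed (use \<kappa> K1.subprob_space_axioms K2.subprob_space_axioms in auto)
qed

section \<open>Gibbs kernels with a potential\<close>

definition partition_fun :: "'b measure \<Rightarrow> ('a \<Rightarrow> 'b \<Rightarrow> real) \<Rightarrow> ('b \<Rightarrow> real) \<Rightarrow> 'a \<Rightarrow> ennreal" where
  "partition_fun N W v x = (\<integral>\<^sup>+y. ennreal (exp (- v y)) \<partial>gibbs N (W x))"

definition sinkhorn_kernel :: "'b measure \<Rightarrow> ('a \<Rightarrow> 'b \<Rightarrow> real) \<Rightarrow> ('b \<Rightarrow> real) \<Rightarrow> 'a \<Rightarrow> 'b measure" where
  "sinkhorn_kernel N W v x = density (gibbs N (W x)) (\<lambda>y. ennreal (exp (- v y)) / partition_fun N W v x)"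

definition kernel_density :: "'b measure \<Rightarrow> ('a \<Rightarrow> 'b \<Rightarrow> real) \<Rightarrow> ('b \<Rightarrow> real) \<Rightarrow> 'a \<Rightarrow> 'b \<Rightarrow> real" where
  "kernel_density N W v x y = exp (- W x y - v y) / enn2real (partition_fun N W v x)"

text \<open>The base measure has the density \<open>exp U\<close> with respect to a finite measure.\<close>

lemma sigma_finite_gibbs_base:
  assumes [measurable]: "U \<in> borel_measurable M" and "prob_space (gibbs M U)"
  shows "sigma_finite_measure M"
proof -
  interpret G: prob_space "gibbs M U" by fact
  have "density (gibbs M U) (\<lambda>x. ennreal (exp (U x))) = density M (\<lambda>x. 1)"
    unfolding gibbs_def
    by (subst density_density_eq) (auto simp flip: ennreal_mult exp_add intro!: density_cong)
  then have "M = density (gibbs M U) (\<lambda>x. ennreal (exp (U x)))"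
    by (simp add: density_1)
  moreover have "sigma_finite_measure (density (gibbs M U) (\<lambda>x. ennreal (exp (U x))))"
    by (subst G.sigma_finite_iff_density_finite) (auto simp: gibbs_def)
  ultimately show ?thesis by simp
qed

lemma nn_integral_gibbs:
  assumes [measurable]: "U \<in> borel_measurable M" "f \<in> borel_measurable M"
  shows "(\<integral>\<^sup>+x. f x \<partial>gibbs M U) = (\<integral>\<^sup>+x. ennreal (exp (- U x)) * f x \<partial>M)"
  unfolding gibbs_def by (rule nn_integral_density) auto

lemma nn_integral_exp_prob_gibbs:
  assumes [measurable]: "U \<in> borel_measurable M" and "prob_space (gibbs M U)"
  shows "(\<integral>\<^sup>+x. ennreal (exp (- U x)) \<partial>M) = 1"
  using prob_space.emeasure_space_1[OF assms(2)]
  by (simp add: gibbs_def emeasure_density cong: nn_integral_cong)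

lemma gibbs_nonnull:
  assumes "space M = UNIV" "f \<in> borel_measurable M" "prob_space (gibbs M f)"
  shows "emeasure M UNIV \<noteq> 0"
proof
  assume "emeasure M UNIV = 0"
  then have "AE x in M. False"
    using AE_iff_measurable[of "space M" M "\<lambda>_. False"] sets.top[of M] by (simp add: assms(1))
  then have "(\<integral>\<^sup>+x. ennreal (exp (- f x)) \<partial>M) = (\<integral>\<^sup>+x. 0 \<partial>M)"
    by (intro nn_integral_cong_AE) auto
  then show False using nn_integral_exp_prob_gibbs[OF assms(2,3)] by simp
qed

text \<open>The kernel \<open>K\<close> with density proportional to \<open>exp (- W x y - v y)\<close>, with normalisation \<open>Z\<close>. Where \<open>Z\<close> is
infinite, \<open>K\<close> is the zero measure; these points enter the Dobrushin coefficient, but they can only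
increase it.\<close>

locale gibbs_kernel = sigma_finite_measure N for M :: "'a measure" and N :: "'b measure" +
  fixes W :: "'a \<Rightarrow> 'b \<Rightarrow> real" and v :: "'b \<Rightarrow> real"
  assumes space_M: "space M = UNIV" and space_N: "space N = UNIV"
    and W_meas: "(\<lambda>(x, y). W x y) \<in> borel_measurable (M \<Otimes>\<^sub>M N)"
    and v_meas [measurable]: "v \<in> borel_measurable N"
    and nonnull: "emeasure N UNIV \<noteq> 0"
begin

abbreviation "Z \<equiv> partition_fun N W v"
abbreviation "K \<equiv> sinkhorn_kernel N W v"
abbreviation "k \<equiv> kernel_density N W v"

lemma UNIV_sets [measurable, simp]: "UNIV \<in> sets N"
  using sets.top[of N] by (simp add: space_N)

lemma W_compose [measurable (raw)]:
  assumes [measurable]: "f \<in> L \<rightarrow>\<^sub>M M" "g \<in> L \<rightarrow>\<^sub>M N"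
  shows "(\<lambda>w. W (f w) (g w)) \<in> borel_measurable L"
  using measurable_compose[OF _ W_meas, of "\<lambda>w. (f w, g w)" L] by simp

lemma W_section [measurable]: "W x \<in> borel_measurable N"
  using W_compose[of "\<lambda>_. x" N "\<lambda>y. y"] by (simp add: space_M)

lemma W_section' [measurable]: "(\<lambda>x. W x y) \<in> borel_measurable M"
  using W_compose[of "\<lambda>x. x" M "\<lambda>_. y"] by (simp add: space_N)

lemma Z_eq: "Z x = (\<integral>\<^sup>+y. ennreal (exp (- W x y - v y)) \<partial>N)"
  unfolding partition_fun_def
  by (subst nn_integral_gibbs) (auto simp flip: ennreal_mult exp_add)

lemma Z_measurable [measurable]: "Z \<in> borel_measurable M"
  unfolding Z_eq[abs_def] by measurable

lemma Z_pos: "Z x \<noteq> 0"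
proof
  assume "Z x = 0"
  then have "AE y in N. False"
    unfolding Z_eq by (subst (asm) nn_integral_0_iff_AE) auto
  then have "emeasure N (space N) = 0"
    using AE_iff_measurable[of "space N" N "\<lambda>_. False"] by simp
  then show False using nonnull by (simp add: space_N)
qed

lemma enn2real_Z_pos: "Z x < \<infinity> \<Longrightarrow> 0 < enn2real (Z x)"
  using Z_pos[of x] by (simp add: enn2real_positive_iff zero_less_iff_neq_zero)

lemma k_measurable: "(\<lambda>(x, y). k x y) \<in> borel_measurable (M \<Otimes>\<^sub>M N)"
  unfolding kernel_density_def by measurable

lemma k_compose [measurable (raw)]:
  assumes [measurable]: "f \<in> L \<rightarrow>\<^sub>M M" "g \<in> L \<rightarrow>\<^sub>M N"
  shows "(\<lambda>w. k (f w) (g w)) \<in> borel_measurable L"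
  unfolding kernel_density_def by measurable

lemma k_section [measurable]: "k x \<in> borel_measurable N"
  using k_compose[of "\<lambda>_. x" N "\<lambda>y. y"] by (simp add: space_M)

lemma k_section' [measurable]: "(\<lambda>x. k x y) \<in> borel_measurable M"
  using k_compose[of "\<lambda>x. x" M "\<lambda>_. y"] by (simp add: space_N)

lemma k_nonneg: "0 \<le> k x y"
  by (simp add: kernel_density_def)

text \<open>Division by an infinite \<open>Z\<close> gives \<open>0\<close> in \<^typ>\<open>ennreal\<close>, and so does division by
\<open>enn2real \<infinity> = 0\<close> in \<^typ>\<open>real\<close>.\<close>

lemma K_eq: "K x = density N (\<lambda>y. ennreal (k x y))"
proof -
  have "ennreal (exp (- W x y)) * (ennreal (exp (- v y)) / Z x) = ennreal (k x y)" for y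
  proof (cases "Z x < \<infinity>")
    case True
    then have "Z x = ennreal (enn2real (Z x))" by simp
    then have "ennreal (exp (- v y)) / Z x = ennreal (exp (- v y) / enn2real (Z x))"
      using enn2real_Z_pos[OF True] by (metis divide_ennreal exp_ge_zero)
    then have "ennreal (exp (- W x y)) * (ennreal (exp (- v y)) / Z x)
        = ennreal (exp (- W x y) * (exp (- v y) / enn2real (Z x)))"
      by (simp flip: ennreal_mult)
    also have "exp (- W x y) * (exp (- v y) / enn2real (Z x)) = k x y"
      by (simp add: kernel_density_def flip: exp_add)
    finally show ?thesis .
  next
    case False
    then have "Z x = \<top>" by (simp flip: less_top)
    then show ?thesis by (simp add: kernel_density_def)
  qed
  then show ?thesis
    unfolding sinkhorn_kernel_def gibbs_def
    by (subst density_density_eq) auto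
qed

lemma k_mass: "Z x < \<infinity> \<Longrightarrow> (\<integral>\<^sup>+y. ennreal (k x y) \<partial>N) = 1"
proof -
  assume Z: "Z x < \<infinity>"
  have "(\<integral>\<^sup>+y. ennreal (k x y) \<partial>N) = (\<integral>\<^sup>+y. ennreal (exp (- W x y - v y)) * ennreal (1 / enn2real (Z x)) \<partial>N)"
    by (simp add: kernel_density_def flip: ennreal_mult)
  also have "\<dots> = Z x * ennreal (1 / enn2real (Z x))"
    unfolding Z_eq by (rule nn_integral_multc) measurable
  also have "Z x = ennreal (enn2real (Z x))" using Z by simp
  finally show ?thesis
    using enn2real_Z_pos[OF Z] by (simp flip: ennreal_mult)
qed

lemma k_mass_le: "(\<integral>\<^sup>+y. ennreal (k x y) \<partial>N) \<le> 1"
proof (cases "Z x < \<infinity>")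
  case False
  then have "Z x = \<top>" by (simp flip: less_top)
  then show ?thesis by (simp add: kernel_density_def)
qed (simp add: k_mass)

lemma sets_K [simp]: "sets (K x) = sets N"
  by (simp add: K_eq)

lemma subprob_K: "subprob_space (K x)"
  by standard (use k_mass_le[of x] in \<open>auto simp: K_eq emeasure_density space_N cong: nn_integral_cong\<close>)

lemma K_measurable: "K \<in> M \<rightarrow>\<^sub>M subprob_algebra N"
proof (rule measurable_subprob_algebra)
  fix A assume [measurable]: "A \<in> sets N"
  show "(\<lambda>x. emeasure (K x) A) \<in> borel_measurable M"
    by (simp add: K_eq emeasure_density)
qed (auto simp: subprob_K)

lemma bind_K:
  assumes M: "sigma_finite_measure M" and f_meas [measurable]: "f \<in> borel_measurable M"
  shows "density M f \<bind> K = density N (\<lambda>y. \<integral>\<^sup>+x. f x * ennreal (k x y) \<partial>M)"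
proof -
  interpret M: sigma_finite_measure M by fact
  interpret MN: pair_sigma_finite M N ..
  have K: "K \<in> density M f \<rightarrow>\<^sub>M subprob_algebra N"
    using K_measurable by simp
  show ?thesis
  proof (rule measure_eqI)
    show "sets (density M f \<bind> K) = sets (density N (\<lambda>y. \<integral>\<^sup>+x. f x * ennreal (k x y) \<partial>M))"
      using sets_bind[of "density M f" K N] by (simp add: space_M)
    fix A assume "A \<in> sets (density M f \<bind> K)"
    then have [measurable]: "A \<in> sets N"
      using sets_bind[of "density M f" K N] by (simp add: space_M)
    have "emeasure (density M f \<bind> K) A = (\<integral>\<^sup>+x. f x * (\<integral>\<^sup>+y. ennreal (k x y) * indicator A y \<partial>N) \<partial>M)"
      by (subst emeasure_bind[OF _ K])
        (simp_all add: space_M nn_integral_density K_eq emeasure_density)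
    also have "\<dots> = (\<integral>\<^sup>+x. \<integral>\<^sup>+y. f x * (ennreal (k x y) * indicator A y) \<partial>N \<partial>M)"
      by (simp add: nn_integral_cmult)
    also have "\<dots> = (\<integral>\<^sup>+y. \<integral>\<^sup>+x. f x * (ennreal (k x y) * indicator A y) \<partial>M \<partial>N)"
      by (rule MN.Fubini'[symmetric]) measurable
    also have "\<dots> = (\<integral>\<^sup>+y. (\<integral>\<^sup>+x. f x * ennreal (k x y) \<partial>M) * indicator A y \<partial>N)"
      by (simp add: nn_integral_multc flip: mult.assoc)
    also have "\<dots> = emeasure (density N (\<lambda>y. \<integral>\<^sup>+x. f x * ennreal (k x y) \<partial>M)) A"
      by (simp add: emeasure_density)
    finally show "emeasure (density M f \<bind> K) A = emeasure (density N (\<lambda>y. \<integral>\<^sup>+x. f x * ennreal (k x y) \<partial>M)) A" .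
  qed
qed

lemma K_overlap:
  assumes "Z x < \<infinity>" "Z z < \<infinity>"
  shows "ennreal (1 - dobrushin K) \<le> (\<integral>\<^sup>+y. ennreal (min (k x y) (k z y)) \<partial>N)"
proof -
  have "ennreal (1 - dobrushin K) \<le> ennreal (1 - tv_dist (K x) (K z))"
    using tv_dist_le_dobrushin[of K N x z] subprob_K by (intro ennreal_leI) simp
  also have "\<dots> \<le> (\<integral>\<^sup>+y. ennreal (min (k x y) (k z y)) \<partial>N)"
    unfolding K_eq by (intro tv_dist_overlap k_section k_nonneg k_mass assms)
  finally show ?thesis .
qed

end

section \<open>One half-step of the iteration\<close>

lemma exp_swap: "exp (- s) * exp (- w - t) = exp (- t) * exp (- w - s :: real)"
proof -
  have "- s + (- w - t) = - t + (- w - s)" by simp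
  then show ?thesis by (simp only: exp_add[symmetric])
qed

text \<open>Two consecutive kernels: \<open>a\<close> is a potential on the first space, \<open>prev\<close> the resulting kernel from the
second space to the first, \<open>v\<close> the potential computed from it, and \<open>cur\<close> the next kernel, from the
first space to the second. For \<open>a = U\<^sub>2\<^sub>n\<close> these are \<open>S\<^sub>2\<^sub>n\<^sub>+\<^sub>1\<close> and \<open>S\<^sub>2\<^sub>n\<^sub>+\<^sub>2\<close>; for the other parity the
two spaces are exchanged.\<close>

locale sinkhorn_step =
  fixes lam :: "'a measure" and nu :: "'b measure" and U :: "'a \<Rightarrow> real" and V :: "'b \<Rightarrow> real"
    and W :: "'a \<Rightarrow> 'b \<Rightarrow> real" and a :: "'a \<Rightarrow> real"
  assumes space_lam: "space lam = UNIV" and space_nu: "space nu = UNIV"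
    and U_meas [measurable]: "U \<in> borel_measurable lam" and V_meas [measurable]: "V \<in> borel_measurable nu"
    and W_meas: "(\<lambda>(x, y). W x y) \<in> borel_measurable (lam \<Otimes>\<^sub>M nu)"
    and a_meas [measurable]: "a \<in> borel_measurable lam"
    and prob_U: "prob_space (gibbs lam U)" and prob_V: "prob_space (gibbs nu V)"
    and Z_prev_finite: "AE y in nu. partition_fun lam (\<lambda>y x. W x y) a y < \<infinity>"
begin

definition "v = stepU lam V (\<lambda>y x. W x y) a"

lemma base_sigma_finite: "sigma_finite_measure lam" "sigma_finite_measure nu"
  by (rule sigma_finite_gibbs_base[OF U_meas prob_U]) (rule sigma_finite_gibbs_base[OF V_meas prob_V])

sublocale lam: sigma_finite_measure lam by (rule base_sigma_finite)
sublocale nu: sigma_finite_measure nu by (rule base_sigma_finite)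
sublocale pair_sigma_finite lam nu ..

sublocale prev: gibbs_kernel nu lam "\<lambda>y x. W x y" a
proof
  show "(\<lambda>(y, x). W x y) \<in> borel_measurable (nu \<Otimes>\<^sub>M lam)"
    using measurable_compose[OF measurable_pair_swap' W_meas] by (simp add: split_beta)
qed (auto simp: space_lam space_nu gibbs_nonnull[OF space_lam U_meas prob_U])

lemma v_eq: "v y = V y + ln (enn2real (prev.Z y))"
  by (simp add: v_def stepU_def partition_fun_def)

lemma v_measurable [measurable]: "v \<in> borel_measurable nu"
  unfolding v_eq[abs_def] by measurable

sublocale cur: gibbs_kernel lam nu W v
  by standard (auto simp: space_lam space_nu gibbs_nonnull[OF space_nu V_meas prob_V] W_meas)

lemma exp_v: "prev.Z y < \<infinity> \<Longrightarrow> exp (- v y) = exp (- V y) / enn2real (prev.Z y)"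
  using prev.enn2real_Z_pos[of y] by (simp add: v_eq exp_diff exp_minus field_simps exp_add)

lemma exp_v_ennreal: "prev.Z y < \<infinity> \<Longrightarrow> ennreal (exp (- v y)) * prev.Z y = ennreal (exp (- V y))"
proof -
  assume Z: "prev.Z y < \<infinity>"
  then have "prev.Z y = ennreal (enn2real (prev.Z y))" by simp
  then have "ennreal (exp (- v y)) * prev.Z y = ennreal (exp (- v y) * enn2real (prev.Z y))"
    by (metis ennreal_mult exp_ge_zero enn2real_nonneg)
  then show ?thesis
    using prev.enn2real_Z_pos[OF Z] by (simp add: exp_v[OF Z])
qed

text \<open>The total mass of the preceding marginal. It follows from Fubini's theorem and the definition
of \<open>v\<close>, and it is the source of the almost everywhere finiteness of all normalisations.\<close>

lemma mass_exp_a_Z: "(\<integral>\<^sup>+x. ennreal (exp (- a x)) * cur.Z x \<partial>lam) = 1"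
proof -
  have "(\<integral>\<^sup>+x. ennreal (exp (- a x)) * cur.Z x \<partial>lam)
      = (\<integral>\<^sup>+x. \<integral>\<^sup>+y. ennreal (exp (- a x)) * ennreal (exp (- W x y - v y)) \<partial>nu \<partial>lam)"
    by (simp add: cur.Z_eq nn_integral_cmult)
  also have "\<dots> = (\<integral>\<^sup>+y. \<integral>\<^sup>+x. ennreal (exp (- a x)) * ennreal (exp (- W x y - v y)) \<partial>lam \<partial>nu)"
    by (rule Fubini'[symmetric]) measurable
  also have "\<dots> = (\<integral>\<^sup>+y. \<integral>\<^sup>+x. ennreal (exp (- v y)) * ennreal (exp (- W x y - a x)) \<partial>lam \<partial>nu)"
    by (simp add: exp_swap flip: ennreal_mult)
  also have "\<dots> = (\<integral>\<^sup>+y. ennreal (exp (- v y)) * prev.Z y \<partial>nu)"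
    by (simp add: prev.Z_eq nn_integral_cmult)
  also have "\<dots> = (\<integral>\<^sup>+y. ennreal (exp (- V y)) \<partial>nu)"
    using Z_prev_finite by (intro nn_integral_cong_AE) (auto elim!: eventually_mono simp: exp_v_ennreal)
  also have "\<dots> = 1" by (rule nn_integral_exp_prob_gibbs[OF V_meas prob_V])
  finally show ?thesis .
qed

lemma Z_finite: "AE x in lam. cur.Z x < \<infinity>"
proof -
  have "AE x in lam. ennreal (exp (- a x)) * cur.Z x \<noteq> \<infinity>"
    using mass_exp_a_Z by (intro nn_integral_noteq_infinite) auto
  then show ?thesis
    by eventually_elim (auto simp: less_top ennreal_mult_eq_top_iff)
qed

definition "prev_marginal = gibbs nu V \<bind> prev.K"
definition "cur_marginal = gibbs lam U \<bind> cur.K"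

definition "r x = exp (- a x) * enn2real (cur.Z x)"

lemma r_measurable [measurable]: "r \<in> borel_measurable lam"
  unfolding r_def[abs_def] by measurable

lemma r_nonneg: "0 \<le> r x"
  by (simp add: r_def)

lemma r_eq: "cur.Z x < \<infinity> \<Longrightarrow> ennreal (r x) = ennreal (exp (- a x)) * cur.Z x"
  by (simp add: r_def ennreal_mult)

lemma r_mass: "(\<integral>\<^sup>+x. ennreal (r x) \<partial>lam) = 1"
proof -
  have "(\<integral>\<^sup>+x. ennreal (r x) \<partial>lam) = (\<integral>\<^sup>+x. ennreal (exp (- a x)) * cur.Z x \<partial>lam)"
    using Z_finite by (intro nn_integral_cong_AE) (auto elim!: eventually_mono simp: r_eq)
  then show ?thesis by (simp add: mass_exp_a_Z)
qed

text \<open>The potential \<open>v\<close> absorbs \<open>V\<close> and the normalisation of the preceding kernel, which turns the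
integral against \<open>exp (- V)\<close> into the normalisation of the current kernel.\<close>

lemma prev_marginal_eq: "prev_marginal = density lam (\<lambda>x. ennreal (r x))"
proof -
  have "prev_marginal = density lam (\<lambda>x. \<integral>\<^sup>+y. ennreal (exp (- V y)) * ennreal (prev.k y x) \<partial>nu)"
    unfolding prev_marginal_def gibbs_def by (rule prev.bind_K[OF base_sigma_finite(2)]) measurable
  also have "\<dots> = density lam (\<lambda>x. ennreal (r x))"
  proof (rule density_cong)
    show "AE x in lam. (\<integral>\<^sup>+y. ennreal (exp (- V y)) * ennreal (prev.k y x) \<partial>nu) = ennreal (r x)"
      using Z_finite AE_space
    proof eventually_elim
      case (elim x)
      have "(\<integral>\<^sup>+y. ennreal (exp (- V y)) * ennreal (prev.k y x) \<partial>nu)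
          = (\<integral>\<^sup>+y. ennreal (exp (- a x)) * ennreal (exp (- W x y - v y)) \<partial>nu)"
      proof (rule nn_integral_cong_AE)
        show "AE y in nu. ennreal (exp (- V y)) * ennreal (prev.k y x) = ennreal (exp (- a x)) * ennreal (exp (- W x y - v y))"
          using Z_prev_finite
        proof eventually_elim
          case (elim y)
          have "exp (- V y) * prev.k y x = exp (- W x y - a x) * exp (- v y)"
            by (simp add: kernel_density_def exp_v[OF elim])
          also have "\<dots> = exp (- a x) * exp (- W x y - v y)"
            by (subst mult.commute) (rule exp_swap)
          finally show ?case by (simp add: prev.k_nonneg flip: ennreal_mult)
        qed
      qed
      also have "\<dots> = ennreal (r x)"
        by (simp add: nn_integral_cmult r_eq[OF elim(1)] cur.Z_eq)
      finally show ?case .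
    qed
  qed measurable
  finally show ?thesis .
qed

lemma cur_marginal_eq: "cur_marginal = density nu (\<lambda>y. \<integral>\<^sup>+x. ennreal (exp (- U x) * cur.k x y) \<partial>lam)"
  unfolding cur_marginal_def gibbs_def
  by (subst cur.bind_K[OF base_sigma_finite(1)]) (simp_all add: ennreal_mult cur.k_nonneg)

text \<open>The point of the iteration: the current kernel maps the preceding marginal to the prescribed one,
because its normalisation cancels.\<close>

lemma r_push:
  assumes Z: "prev.Z y < \<infinity>"
  shows "(\<integral>\<^sup>+x. ennreal (r x * cur.k x y) \<partial>lam) = ennreal (exp (- V y))"
proof -
  have "(\<integral>\<^sup>+x. ennreal (r x * cur.k x y) \<partial>lam)
      = (\<integral>\<^sup>+x. ennreal (exp (- v y)) * ennreal (exp (- W x y - a x)) \<partial>lam)"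
  proof (rule nn_integral_cong_AE)
    show "AE x in lam. ennreal (r x * cur.k x y) = ennreal (exp (- v y)) * ennreal (exp (- W x y - a x))"
      using Z_finite
    proof eventually_elim
      case (elim x)
      have "r x * cur.k x y = exp (- a x) * exp (- W x y - v y)"
        using cur.enn2real_Z_pos[OF elim] by (simp add: r_def kernel_density_def)
      also have "\<dots> = exp (- v y) * exp (- W x y - a x)"
        by (rule exp_swap)
      finally show ?case by (simp flip: ennreal_mult)
    qed
  qed
  also have "\<dots> = ennreal (exp (- v y)) * prev.Z y"
    by (simp add: nn_integral_cmult prev.Z_eq)
  also have "\<dots> = ennreal (exp (- V y))"
    by (rule exp_v_ennreal[OF Z])
  finally show ?thesis .
qed

lemma nuV_eq: "gibbs nu V = density nu (\<lambda>y. \<integral>\<^sup>+x. ennreal (r x * cur.k x y) \<partial>lam)"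
  unfolding gibbs_def using Z_prev_finite
  by (intro density_cong) (auto elim!: eventually_mono simp: r_push)

lemma k_mass_AE: "AE x in lam. (\<integral>\<^sup>+y. ennreal (cur.k x y) \<partial>nu) = 1"
  using Z_finite by eventually_elim (rule cur.k_mass)

lemma overlap_AE:
  "AE x in lam. AE z in lam. ennreal (1 - dobrushin cur.K) \<le> (\<integral>\<^sup>+y. ennreal (min (cur.k x y) (cur.k z y)) \<partial>nu)"
  using Z_finite
proof eventually_elim
  case (elim x)
  show ?case using Z_finite by eventually_elim (rule cur.K_overlap[OF elim])
qed

lemmas U_mass = nn_integral_exp_prob_gibbs[OF U_meas prob_U]

lemma Phi_div_step:
  assumes \<Phi>: "entropy_function \<Phi>"
  shows "Phi_div \<Phi> cur_marginal (gibbs nu V) \<le> ereal (dobrushin cur.K) * Phi_div \<Phi> (gibbs lam U) prev_marginal"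
    and "Phi_div \<Phi> (gibbs nu V) cur_marginal \<le> ereal (dobrushin cur.K) * Phi_div \<Phi> prev_marginal (gibbs lam U)"
    and "0 \<le> Phi_div \<Phi> (gibbs lam U) prev_marginal"
    and "0 \<le> Phi_div \<Phi> prev_marginal (gibbs lam U)"
proof -
  note \<delta> = dobrushin_bounds[OF cur.subprob_K cur.sets_K]
  have U_meas': "(\<lambda>x. exp (- U x)) \<in> borel_measurable lam" by measurable
  show "Phi_div \<Phi> cur_marginal (gibbs nu V) \<le> ereal (dobrushin cur.K) * Phi_div \<Phi> (gibbs lam U) prev_marginal"
    unfolding cur_marginal_eq nuV_eq prev_marginal_eq gibbs_def[of lam]
    by (rule Phi_div_kernel_contraction[OF \<Phi> base_sigma_finite U_meas' r_measurable exp_ge_zero r_nonneg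
        U_mass r_mass cur.k_measurable cur.k_nonneg k_mass_AE \<delta> overlap_AE])
  show "Phi_div \<Phi> (gibbs nu V) cur_marginal \<le> ereal (dobrushin cur.K) * Phi_div \<Phi> prev_marginal (gibbs lam U)"
    unfolding cur_marginal_eq nuV_eq prev_marginal_eq gibbs_def[of lam]
    by (rule Phi_div_kernel_contraction[OF \<Phi> base_sigma_finite r_measurable U_meas' r_nonneg exp_ge_zero
        r_mass U_mass cur.k_measurable cur.k_nonneg k_mass_AE \<delta> overlap_AE])
  interpret ur: density_pair lam "\<lambda>x. exp (- U x)" r
    by standard (use U_mass r_mass r_nonneg in auto)
  interpret ru: density_pair lam r "\<lambda>x. exp (- U x)"
    by standard (use U_mass r_mass r_nonneg in auto)
  show "0 \<le> Phi_div \<Phi> (gibbs lam U) prev_marginal"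
    unfolding prev_marginal_eq gibbs_def by (rule ur.Phi_div_nonneg[OF \<Phi>])
  show "0 \<le> Phi_div \<Phi> prev_marginal (gibbs lam U)"
    unfolding prev_marginal_eq gibbs_def by (rule ru.Phi_div_nonneg[OF \<Phi>])
qed

end

section \<open>Uniform bounds from a cross-ratio condition\<close>

text \<open>A lower bound for the cross ratios of \<open>exp (- W)\<close>. Adding a function of \<open>x\<close> or of \<open>y\<close> alone to \<open>W\<close>
does not change them, nor does transposing \<open>W\<close>.\<close>

definition cross_ratio_bound :: "real \<Rightarrow> ('a \<Rightarrow> 'b \<Rightarrow> real) \<Rightarrow> bool" where
  "cross_ratio_bound \<kappa> W \<longleftrightarrow> 0 < \<kappa> \<and>
     (\<forall>x z y t. \<kappa> * (exp (- W x y) * exp (- W z t)) \<le> exp (- W x t) * exp (- W z y))"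

lemma cross_ratio_bound_transpose:
  "cross_ratio_bound \<kappa> W \<Longrightarrow> cross_ratio_bound \<kappa> (\<lambda>y x. W x y)"
  by (simp add: cross_ratio_bound_def mult.commute)

lemma cross_ratio_bound_le_1:
  assumes "cross_ratio_bound \<kappa> W" shows "\<kappa> \<le> 1"
proof -
  have "\<kappa> * (exp (- W undefined undefined) * exp (- W undefined undefined))
      \<le> exp (- W undefined undefined) * exp (- W undefined undefined)"
    using assms unfolding cross_ratio_bound_def by blast
  then show ?thesis by simp
qed

context gibbs_kernel
begin

text \<open>The cross-ratio bound makes \<open>exp (- W x _)\<close> and \<open>exp (- W x0 _)\<close> comparable up to a constant.\<close>

lemma Z_finite_everywhere:
  assumes CR: "cross_ratio_bound \<kappa> W" and fin: "AE x in M. Z x < \<infinity>" and M: "emeasure M UNIV \<noteq> 0"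
  shows "Z x < \<infinity>"
proof -
  obtain x0 where x0: "Z x0 < \<infinity>"
  proof (rule ccontr)
    assume "\<not> thesis"
    then have "\<And>x. \<not> Z x < \<infinity>" using that by blast
    then have "AE x in M. False" using fin by simp
    then show False
      using AE_iff_measurable[of "space M" M "\<lambda>_. False"] M sets.top[of M] by (simp add: space_M)
  qed
  (* the comparison constant is the cross-ratio bound at an arbitrary reference point *)
  define C where "C = exp (- W x undefined) / (\<kappa> * exp (- W x0 undefined))"
  have \<kappa>: "0 < \<kappa>" using CR by (simp add: cross_ratio_bound_def)
  have C: "exp (- W x y) \<le> C * exp (- W x0 y)" for y
  proof -
    have "\<kappa> * (exp (- W x y) * exp (- W x0 undefined)) \<le> exp (- W x undefined) * exp (- W x0 y)"
      using CR by (simp add: cross_ratio_bound_def)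
    then show ?thesis using \<kappa> by (simp add: C_def field_simps)
  qed
  have "Z x \<le> (\<integral>\<^sup>+y. ennreal C * ennreal (exp (- W x0 y - v y)) \<partial>N)"
    unfolding Z_eq
  proof (rule nn_integral_mono)
    fix y
    have "exp (- W x y) * exp (- v y) \<le> C * exp (- W x0 y) * exp (- v y)"
      using C[of y] by (rule mult_right_mono) simp
    then have "exp (- W x y - v y) \<le> C * exp (- W x0 y - v y)"
      by (simp add: mult.assoc flip: exp_add)
    then show "ennreal (exp (- W x y - v y)) \<le> ennreal C * ennreal (exp (- W x0 y - v y))"
      using \<kappa> by (simp add: C_def flip: ennreal_mult)
  qed
  also have "\<dots> = ennreal C * Z x0"
    unfolding Z_eq by (rule nn_integral_cmult) measurable
  also have "\<dots> < \<infinity>"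
    using x0 by (simp add: ennreal_mult_less_top)
  finally show ?thesis .
qed

text \<open>Potentials and normalisations cancel in the cross ratio of \<open>k\<close>, so
\<open>\<kappa> * k z y * k x t \<le> k x y * k z t\<close>; integrate over \<open>t\<close>.\<close>

lemma k_ratio:
  assumes CR: "cross_ratio_bound \<kappa> W" and Z: "Z x < \<infinity>" "Z z < \<infinity>"
  shows "\<kappa> * k z y \<le> k x y"
proof -
  have \<kappa>: "0 < \<kappa>" using CR by (simp add: cross_ratio_bound_def)
  have cross: "\<kappa> * k z y * k x t \<le> k x y * k z t" for t
  proof -
    have "\<kappa> * (exp (- W z y) * exp (- W x t)) \<le> exp (- W z t) * exp (- W x y)"
      using CR by (simp add: cross_ratio_bound_def)
    then have "\<kappa> * (exp (- W z y) * exp (- W x t)) * (exp (- v y) * exp (- v t))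
        \<le> exp (- W z t) * exp (- W x y) * (exp (- v y) * exp (- v t))"
      by (rule mult_right_mono) simp
    then have "\<kappa> * (exp (- W z y - v y) * exp (- W x t - v t)) \<le> exp (- W x y - v y) * exp (- W z t - v t)"
      by (simp add: exp_diff exp_minus field_simps)
    then have "\<kappa> * (exp (- W z y - v y) * exp (- W x t - v t)) / (enn2real (Z x) * enn2real (Z z))
        \<le> exp (- W x y - v y) * exp (- W z t - v t) / (enn2real (Z x) * enn2real (Z z))"
      by (rule divide_right_mono) simp
    then show ?thesis
      by (simp add: kernel_density_def mult.commute mult.left_commute)
  qed
  have "ennreal (\<kappa> * k z y) = (\<integral>\<^sup>+t. ennreal (\<kappa> * k z y) * ennreal (k x t) \<partial>N)"
    by (simp add: nn_integral_cmult k_mass[OF Z(1)])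
  also have "\<dots> \<le> (\<integral>\<^sup>+t. ennreal (k x y) * ennreal (k z t) \<partial>N)"
    using cross \<kappa> k_nonneg by (intro nn_integral_mono) (simp flip: ennreal_mult)
  also have "\<dots> = ennreal (k x y)"
    by (simp add: nn_integral_cmult k_mass[OF Z(2)])
  finally show ?thesis by (simp add: k_nonneg)
qed

lemma dobrushin_le:
  assumes CR: "cross_ratio_bound \<kappa> W" and Z: "\<And>x. Z x < \<infinity>"
  shows "dobrushin K \<le> 1 - \<kappa>"
proof -
  have \<kappa>: "0 < \<kappa>" using CR by (simp add: cross_ratio_bound_def)
  have "tv_dist (K x) (K z) \<le> 1 - \<kappa>" for x z
    unfolding K_eq
    by (intro tv_dist_density_ratio_le k_section k_nonneg k_mass k_ratio[OF CR] Z \<kappa> cross_ratio_bound_le_1[OF CR])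
  then show ?thesis
    unfolding dobrushin_def by (intro cSUP_least) auto
qed

end

lemma abs_ln_le:
  fixes x \<kappa> :: real
  assumes "0 < \<kappa>" "\<kappa> \<le> 1" "\<kappa> \<le> x"
  shows "\<bar>ln x\<bar> \<le> \<bar>x - 1\<bar> / \<kappa>"
proof (cases "1 \<le> x")
  case True
  have "ln x \<le> x - 1" using True by (intro ln_le_minus_one) auto
  also have "\<dots> \<le> (x - 1) / \<kappa>"
    using assms True by (simp add: le_divide_eq mult_left_le)
  finally show ?thesis using True by simp
next
  case False
  have x: "0 < x" using assms by linarith
  have "- ln x = ln (1 / x)" using x by (simp add: ln_div)
  also have "\<dots> \<le> 1 / x - 1" using x by (intro ln_le_minus_one) auto
  also have "\<dots> = (1 - x) / x" using x by (simp add: diff_divide_distrib)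
  also have "\<dots> \<le> (1 - x) / \<kappa>" using False assms x by (intro divide_left_mono) auto
  finally show ?thesis using False x by simp
qed

context sinkhorn_step
begin

lemma density_pair_step: "density_pair lam (\<lambda>x. exp (- U x)) r"
  by standard (use U_mass r_mass r_nonneg in auto)

lemma density_pair_step': "density_pair lam r (\<lambda>x. exp (- U x))"
  by standard (use U_mass r_mass r_nonneg in auto)

lemma Phi_div_tv_le_2:
  "Phi_div (\<lambda>u v. ereal \<bar>u - v\<bar>) (gibbs lam U) prev_marginal \<le> 2"
  "Phi_div (\<lambda>u v. ereal \<bar>u - v\<bar>) prev_marginal (gibbs lam U) \<le> 2"
  unfolding prev_marginal_eq gibbs_def
  by (simp_all add: density_pair.Phi_div_tv[OF density_pair_step] density_pair.Phi_div_tv[OF density_pair_step'])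

text \<open>Integrating \<open>k_ratio\<close> against the preceding marginal gives \<open>k x y \<le> exp (- V y) / \<kappa>\<close>, and against
\<open>exp (- U)\<close> and then \<open>r\<close> it gives the lower bound \<open>\<kappa>\<close> for the relative density \<open>F\<close>. Since both
\<open>exp (- U)\<close> and \<open>r\<close> are integrated against the same kernel, \<open>F - 1\<close> is controlled by their
\<open>L\<^sup>1\<close>-distance.\<close>

lemma log_density_step:
  assumes CR: "cross_ratio_bound \<kappa> W"
  shows "log_density_norm (gibbs nu V) cur_marginal
    \<le> ereal (1 / \<kappa>\<^sup>2) * Phi_div (\<lambda>u v. ereal \<bar>u - v\<bar>) (gibbs lam U) prev_marginal"
proof -
  have \<kappa>: "0 < \<kappa>" "\<kappa> \<le> 1"
    using CR cross_ratio_bound_le_1[OF CR] by (auto simp: cross_ratio_bound_def)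
  have Zp: "prev.Z y < \<infinity>" for y
    by (rule prev.Z_finite_everywhere[OF cross_ratio_bound_transpose[OF CR] Z_prev_finite
        gibbs_nonnull[OF space_nu V_meas prob_V]])
  have Z: "cur.Z x < \<infinity>" for x
    by (rule cur.Z_finite_everywhere[OF CR Z_finite gibbs_nonnull[OF space_lam U_meas prob_U]])
  note ratio = cur.k_ratio[OF CR Z Z]
  have upper: "cur.k z y \<le> exp (- V y) / \<kappa>" for z y
  proof -
    have "ennreal (\<kappa> * cur.k z y) = (\<integral>\<^sup>+x. ennreal (r x) * ennreal (\<kappa> * cur.k z y) \<partial>lam)"
      by (simp add: nn_integral_multc r_mass)
    also have "\<dots> \<le> (\<integral>\<^sup>+x. ennreal (r x * cur.k x y) \<partial>lam)"
      using ratio r_nonneg \<kappa> cur.k_nonneg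
      by (intro nn_integral_mono) (auto simp flip: ennreal_mult intro!: ennreal_leI mult_left_mono)
    also have "\<dots> = ennreal (exp (- V y))" by (rule r_push[OF Zp])
    finally show ?thesis using \<kappa> by (simp add: le_divide_eq mult.commute)
  qed
  have int_f: "integrable lam (\<lambda>x. f x * cur.k x y)" if "integrable lam f" for f y
  proof (rule Bochner_Integration.integrable_bound)
    show "integrable lam (\<lambda>x. f x * (exp (- V y) / \<kappa>))" using that by simp
    show "AE x in lam. norm (f x * cur.k x y) \<le> norm (f x * (exp (- V y) / \<kappa>))"
      using upper cur.k_nonneg \<kappa>
      by (auto simp: abs_mult simp del: times_divide_eq_right intro!: AE_I2 mult_left_mono)
    show "(\<lambda>x. f x * cur.k x y) \<in> borel_measurable lam" using that by measurable
  qed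
  have U_int: "integrable lam (\<lambda>x. exp (- U x))" and r_int: "integrable lam r"
    using U_mass r_mass r_nonneg by (auto intro!: integrableI_nonneg)
  define G where "G y = (\<integral>x. exp (- U x) * cur.k x y \<partial>lam)" for y
  have G_eq: "ennreal (G y) = (\<integral>\<^sup>+x. ennreal (exp (- U x) * cur.k x y) \<partial>lam)" for y
    unfolding G_def using int_f[OF U_int] cur.k_nonneg
    by (intro nn_integral_eq_integral[symmetric]) auto
  have V_eq: "exp (- V y) = (\<integral>x. r x * cur.k x y \<partial>lam)" for y
    using r_push[OF Zp, of y] r_nonneg cur.k_nonneg by (simp add: integral_eq_nn_integral)
  have lower: "\<kappa> * exp (- V y) \<le> G y" for y
  proof -
    have *: "\<kappa> * cur.k z y \<le> G y" for z
    proof -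
      have "ennreal (\<kappa> * cur.k z y) = (\<integral>\<^sup>+x. ennreal (exp (- U x)) * ennreal (\<kappa> * cur.k z y) \<partial>lam)"
        by (simp add: nn_integral_multc U_mass)
      also have "\<dots> \<le> ennreal (G y)"
        unfolding G_eq using ratio \<kappa> cur.k_nonneg
        by (intro nn_integral_mono) (auto simp flip: ennreal_mult intro!: ennreal_leI mult_left_mono)
      finally show ?thesis
        using cur.k_nonneg by (simp add: G_def)
    qed
    have "\<kappa> * exp (- V y) = (\<integral>x. r x * (\<kappa> * cur.k x y) \<partial>lam)"
      unfolding V_eq by (simp add: mult.left_commute)
    also have "\<dots> \<le> (\<integral>x. r x * G y \<partial>lam)"
      using * r_nonneg int_f[OF r_int] r_int
      by (intro integral_mono mult_left_mono) (auto simp: mult.left_commute)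
    also have "\<dots> = G y"
      using r_mass r_nonneg by (simp add: integral_eq_nn_integral)
    finally show ?thesis .
  qed
  interpret dp: density_pair lam "\<lambda>x. exp (- U x)" r by (rule density_pair_step)
  define L where "L = (\<integral>x. \<bar>exp (- U x) - r x\<bar> \<partial>lam)"
  have L_nn: "0 \<le> L" by (simp add: L_def)
  define F where "F y = G y / exp (- V y)" for y
  have F_lower: "\<kappa> \<le> F y" for y
    using lower[of y] by (simp add: F_def le_divide_eq)
  have F_close: "\<bar>F y - 1\<bar> \<le> L / \<kappa>" for y
  proof -
    have "\<bar>G y - exp (- V y)\<bar> = \<bar>\<integral>x. (exp (- U x) - r x) * cur.k x y \<partial>lam\<bar>"
      unfolding G_def V_eq using int_f[OF U_int] int_f[OF r_int] by (simp add: left_diff_distrib)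
    also have "\<dots> \<le> (\<integral>x. \<bar>(exp (- U x) - r x) * cur.k x y\<bar> \<partial>lam)"
      by (rule integral_abs_bound)
    also have "\<dots> \<le> (\<integral>x. \<bar>exp (- U x) - r x\<bar> * (exp (- V y) / \<kappa>) \<partial>lam)"
    proof (rule integral_mono)
      show "integrable lam (\<lambda>x. \<bar>(exp (- U x) - r x) * cur.k x y\<bar>)"
        using int_f[of "\<lambda>x. exp (- U x) - r x"] U_int r_int by simp
      show "integrable lam (\<lambda>x. \<bar>exp (- U x) - r x\<bar> * (exp (- V y) / \<kappa>))"
        using dp.Phi_div_tv(1) by simp
      fix x
      show "\<bar>(exp (- U x) - r x) * cur.k x y\<bar> \<le> \<bar>exp (- U x) - r x\<bar> * (exp (- V y) / \<kappa>)"
        using upper[of x y] cur.k_nonneg[of x y]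
        by (simp add: abs_mult mult_left_mono del: times_divide_eq_right)
    qed
    also have "\<dots> = L / \<kappa> * exp (- V y)" by (simp add: L_def)
    finally have "\<bar>G y - exp (- V y)\<bar> / exp (- V y) \<le> L / \<kappa>"
      by (simp add: divide_le_eq)
    moreover have "F y - 1 = (G y - exp (- V y)) / exp (- V y)"
      by (simp add: F_def diff_divide_distrib)
    ultimately show ?thesis by (simp add: abs_divide)
  qed
  have F_ln: "\<bar>ln (F y)\<bar> \<le> L / \<kappa>\<^sup>2" for y
  proof -
    have "\<bar>ln (F y)\<bar> \<le> \<bar>F y - 1\<bar> / \<kappa>" by (rule abs_ln_le[OF \<kappa> F_lower])
    also have "\<dots> \<le> L / \<kappa> / \<kappa>" using F_close[of y] \<kappa> by (intro divide_right_mono) auto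
    finally show ?thesis by (simp add: power2_eq_square)
  qed
  have G_meas [measurable]: "G \<in> borel_measurable nu"
    unfolding G_def[abs_def] by measurable
  have F_meas [measurable]: "F \<in> borel_measurable nu"
    unfolding F_def[abs_def] by measurable
  have "density (gibbs nu V) (\<lambda>y. ennreal (F y)) = cur_marginal"
  proof -
    have "density (gibbs nu V) (\<lambda>y. ennreal (F y)) = density nu (\<lambda>y. ennreal (exp (- V y)) * ennreal (F y))"
      unfolding gibbs_def by (subst density_density_eq) auto
    also have "\<dots> = density nu (\<lambda>y. ennreal (G y))"
      using F_lower \<kappa> by (intro density_cong AE_I2) (auto simp: F_def simp flip: ennreal_mult' )
    finally show ?thesis by (simp add: G_eq cur_marginal_eq)
  qed
  then have "log_density_norm (gibbs nu V) cur_marginal \<le> (SUP y \<in> space (gibbs nu V). ereal \<bar>ln (F y)\<bar>)"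
    unfolding log_density_norm_def using F_lower \<kappa>
    by (intro INF_lower) (auto simp: gibbs_def intro: less_le_trans)
  also have "\<dots> \<le> ereal (L / \<kappa>\<^sup>2)"
    using F_ln by (intro SUP_least) auto
  also have "\<dots> = ereal (1 / \<kappa>\<^sup>2) * Phi_div (\<lambda>u v. ereal \<bar>u - v\<bar>) (gibbs lam U) prev_marginal"
    unfolding prev_marginal_eq gibbs_def by (simp add: dp.Phi_div_tv L_def)
  finally show ?thesis .
qed

lemma dobrushin_cur_le:
  assumes CR: "cross_ratio_bound \<kappa> W"
  shows "dobrushin cur.K \<le> 1 - \<kappa>"
  by (intro cur.dobrushin_le[OF CR] cur.Z_finite_everywhere[OF CR Z_finite]
      gibbs_nonnull[OF space_lam U_meas prob_U])

lemma dobrushin_prev_le: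
  assumes CR: "cross_ratio_bound \<kappa> W"
  shows "dobrushin prev.K \<le> 1 - \<kappa>"
  using cross_ratio_bound_transpose[OF CR]
  by (rule prev.dobrushin_le) (rule prev.Z_finite_everywhere[OF cross_ratio_bound_transpose[OF CR]
      Z_prev_finite gibbs_nonnull[OF space_nu V_meas prob_V]])

end

text \<open>The cross ratio is a product of two ratios of the form that \<open>jQ\<close> bounds, one at \<open>y\<close> and one at \<open>t\<close>.\<close>

lemma jQ_cross_ratio:
  assumes "0 < jQ W"
  shows "cross_ratio_bound ((jQ W)\<^sup>2) W"
proof -
  have j: "jQ W \<le> exp (W x2 y - W x1 y)" for x1 x2 y
  proof -
    have "bdd_below (range (\<lambda>(x1, x2, y). exp (W x2 y - W x1 y)))"
      by (intro bdd_belowI[of _ 0]) auto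
    then show ?thesis
      unfolding jQ_def using cINF_lower[of "\<lambda>(x1, x2, y). exp (W x2 y - W x1 y)" UNIV "(x1, x2, y)"] by simp
  qed
  have j': "jQ W * exp (- W x2 y) \<le> exp (- W x1 y)" for x1 x2 y
    using j[of x2 y x1] by (simp add: exp_diff exp_minus field_simps)
  have "(jQ W)\<^sup>2 * (exp (- W x y) * exp (- W z t)) \<le> exp (- W x t) * exp (- W z y)" for x z y t
  proof -
    have "(jQ W * exp (- W z t)) * (jQ W * exp (- W x y)) \<le> exp (- W x t) * exp (- W z y)"
      using assms by (intro mult_mono j') auto
    then show ?thesis by (simp add: power2_eq_square ac_simps)
  qed
  then show ?thesis using assms by (simp add: cross_ratio_bound_def)
qed

section \<open>Convergence of the iterations\<close>

lemma sinkS_even_eq: "sinkS_even lam nu U V W n = sinkhorn_kernel nu W (sinkV lam nu U V W n)"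
  by (simp add: fun_eq_iff sinkS_even_def sinkhorn_kernel_def partition_fun_def)

lemma sinkS_odd_eq: "sinkS_odd lam nu U V W n = sinkhorn_kernel lam (\<lambda>y x. W x y) (sinkU lam nu U V W n)"
  by (simp add: fun_eq_iff sinkS_odd_def sinkhorn_kernel_def partition_fun_def)

lemma stepV_eq_stepU: "stepV lam V W u = stepU lam V (\<lambda>y x. W x y) u"
  by (simp add: fun_eq_iff stepV_def stepU_def)

text \<open>The normalisation of the first kernel, assumed for every \<open>x\<close>, starts the induction; all later
normalisations are finite almost everywhere by \<open>mass_exp_a_Z\<close>.\<close>

locale sinkhorn =
  fixes lam :: "'a measure" and nu :: "'b measure" and U :: "'a \<Rightarrow> real" and V :: "'b \<Rightarrow> real"
    and W :: "'a \<Rightarrow> 'b \<Rightarrow> real"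
  assumes space_lam: "space lam = UNIV" and space_nu: "space nu = UNIV"
    and U_meas: "U \<in> borel_measurable lam" and V_meas: "V \<in> borel_measurable nu"
    and W_meas: "(\<lambda>(x, y). W x y) \<in> borel_measurable (lam \<Otimes>\<^sub>M nu)"
    and prob_U: "prob_space (gibbs lam U)" and prob_V: "prob_space (gibbs nu V)"
    and Q_mass: "\<And>x. emeasure (gibbs nu (W x)) UNIV = 1"
begin

abbreviation "vn \<equiv> sinkV lam nu U V W"
abbreviation "un \<equiv> sinkU lam nu U V W"
abbreviation "pe \<equiv> sinkpi_even lam nu U V W"
abbreviation "po \<equiv> sinkpi_odd lam nu U V W"
abbreviation "chi \<equiv> chiS lam nu U V W"

lemma W_meas': "(\<lambda>(y, x). W x y) \<in> borel_measurable (nu \<Otimes>\<^sub>M lam)"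
  using measurable_compose[OF measurable_pair_swap' W_meas] by (simp add: split_beta)

lemma un_eq: "un n = stepU nu U W (vn n)"
  by (simp add: sinkU_def)

lemma vn_Suc: "vn (Suc n) = stepU lam V (\<lambda>y x. W x y) (un n)"
  by (simp add: sinkU_def stepV_eq_stepU)

lemma odd_stepI:
  assumes "vn n \<in> borel_measurable nu" "AE x in lam. partition_fun nu W (vn n) x < \<infinity>"
  shows "sinkhorn_step nu lam V U (\<lambda>y x. W x y) (vn n)"
  by (intro sinkhorn_step.intro space_nu space_lam V_meas U_meas W_meas' prob_V prob_U assms)

lemma even_step_of_odd:
  assumes "sinkhorn_step nu lam V U (\<lambda>y x. W x y) (vn n)"
  shows "sinkhorn_step lam nu U V W (un n)"
proof -
  interpret odd: sinkhorn_step nu lam V U "\<lambda>y x. W x y" "vn n" by fact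
  have v: "odd.v = un n" by (simp add: odd.v_def un_eq)
  show ?thesis
    using odd.v_measurable odd.Z_finite unfolding v
    by (intro sinkhorn_step.intro space_nu space_lam V_meas U_meas W_meas prob_V prob_U)
qed

lemma odd_step: "sinkhorn_step nu lam V U (\<lambda>y x. W x y) (vn n)"
proof (induction n)
  case 0
  have "partition_fun nu W (vn 0) x = 1" for x
    using Q_mass[of x] space_nu by (simp add: partition_fun_def gibbs_def)
  then show ?case by (intro odd_stepI) auto
next
  case (Suc n)
  interpret even: sinkhorn_step lam nu U V W "un n" by (rule even_step_of_odd[OF Suc])
  have v: "even.v = vn (Suc n)" unfolding vn_Suc by (rule even.v_def)
  show ?case
    using even.v_measurable even.Z_finite by (intro odd_stepI) (simp_all add: v del: sinkV.simps)
qed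

lemma even_step: "sinkhorn_step lam nu U V W (un n)"
  by (rule even_step_of_odd[OF odd_step])

sublocale odd: sinkhorn_step nu lam V U "\<lambda>y x. W x y" "vn n" for n by (rule odd_step)
sublocale even: sinkhorn_step lam nu U V W "un n" for n by (rule even_step)

lemma odd_v: "odd.v n = un n" by (simp add: odd.v_def un_eq)
lemma even_v: "even.v n = vn (Suc n)" unfolding vn_Suc by (rule even.v_def)

lemma marginals:
  "odd.prev_marginal n = pe n" "odd.cur_marginal n = po n"
  "even.prev_marginal n = po n" "even.cur_marginal n = pe (Suc n)"
  unfolding odd.prev_marginal_def odd.cur_marginal_def even.prev_marginal_def even.cur_marginal_def
    sinkpi_even_def sinkpi_odd_def sinkS_even_eq sinkS_odd_eq odd_v even_v
  by (rule refl)+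

lemma kernels:
  "sinkS_even lam nu U V W n = sinkhorn_kernel nu W (vn n)"
  "sinkS_odd lam nu U V W n = sinkhorn_kernel lam (\<lambda>y x. W x y) (odd.v n)"
  "sinkS_even lam nu U V W (Suc n) = sinkhorn_kernel nu W (even.v n)"
  unfolding odd_v even_v by (rule sinkS_even_eq sinkS_odd_eq)+

lemma dobrushin_even: "0 \<le> dobrushin (sinkS_even lam nu U V W n)" "dobrushin (sinkS_even lam nu U V W n) \<le> 1"
  unfolding kernels(1) by (rule dobrushin_bounds[OF odd.prev.subprob_K odd.prev.sets_K])+

lemma dobrushin_odd: "0 \<le> dobrushin (sinkS_odd lam nu U V W n)" "dobrushin (sinkS_odd lam nu U V W n) \<le> 1"
  unfolding kernels(2) by (rule dobrushin_bounds[OF odd.cur.subprob_K odd.cur.sets_K])+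

lemma dobrushin_le_chi:
  "dobrushin (sinkS_even lam nu U V W n) \<le> chi" "dobrushin (sinkS_odd lam nu U V W n) \<le> chi"
proof -
  have "dobrushin (sinkS_even lam nu U V W n) \<le> (SUP n. dobrushin (sinkS_even lam nu U V W n))"
    using dobrushin_even(2) by (intro cSUP_upper bdd_aboveI[of _ 1]) auto
  then show "dobrushin (sinkS_even lam nu U V W n) \<le> chi" by (simp add: chiS_def)
  have "dobrushin (sinkS_odd lam nu U V W n) \<le> (SUP n. dobrushin (sinkS_odd lam nu U V W n))"
    using dobrushin_odd(2) by (intro cSUP_upper bdd_aboveI[of _ 1]) auto
  then show "dobrushin (sinkS_odd lam nu U V W n) \<le> chi" by (simp add: chiS_def)
qed

lemma chi_nonneg: "0 \<le> chi"
  using dobrushin_even(1)[of 0] dobrushin_le_chi(1)[of 0] by linarith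

lemma ereal_le_chi_mult:
  "D \<le> ereal d * D' \<Longrightarrow> d \<le> chi \<Longrightarrow> 0 \<le> D' \<Longrightarrow> D \<le> ereal chi * D'"
  by (meson ereal_less_eq(3) ereal_mult_right_mono order_trans)

lemma half_steps:
  assumes \<Phi>: "entropy_function \<Phi>"
  shows "Phi_div \<Phi> (po n) (gibbs lam U) \<le> ereal chi * Phi_div \<Phi> (gibbs nu V) (pe n)"
    and "Phi_div \<Phi> (gibbs lam U) (po n) \<le> ereal chi * Phi_div \<Phi> (pe n) (gibbs nu V)"
    and "Phi_div \<Phi> (pe (Suc n)) (gibbs nu V) \<le> ereal chi * Phi_div \<Phi> (gibbs lam U) (po n)"
    and "Phi_div \<Phi> (gibbs nu V) (pe (Suc n)) \<le> ereal chi * Phi_div \<Phi> (po n) (gibbs lam U)"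
proof -
  note o = odd.Phi_div_step[OF \<Phi>, of n, unfolded marginals kernels(2)[symmetric]]
  note e = even.Phi_div_step[OF \<Phi>, of n, unfolded marginals kernels(3)[symmetric]]
  show "Phi_div \<Phi> (po n) (gibbs lam U) \<le> ereal chi * Phi_div \<Phi> (gibbs nu V) (pe n)"
    by (rule ereal_le_chi_mult[OF o(1) dobrushin_le_chi(2) o(3)])
  show "Phi_div \<Phi> (gibbs lam U) (po n) \<le> ereal chi * Phi_div \<Phi> (pe n) (gibbs nu V)"
    by (rule ereal_le_chi_mult[OF o(2) dobrushin_le_chi(2) o(4)])
  show "Phi_div \<Phi> (pe (Suc n)) (gibbs nu V) \<le> ereal chi * Phi_div \<Phi> (gibbs lam U) (po n)"
    by (rule ereal_le_chi_mult[OF e(1) dobrushin_le_chi(1) e(3)])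
  show "Phi_div \<Phi> (gibbs nu V) (pe (Suc n)) \<le> ereal chi * Phi_div \<Phi> (po n) (gibbs lam U)"
    by (rule ereal_le_chi_mult[OF e(2) dobrushin_le_chi(1) e(4)])
qed

lemma chi_mult_mono: "D \<le> ereal chi * D' \<Longrightarrow> ereal chi * D \<le> ereal (chi^2) * D'"
  using ereal_mult_left_mono[of D "ereal chi * D'" "ereal chi"] chi_nonneg
  by (simp add: power2_eq_square mult.assoc[symmetric])

lemma chi_lt_1:
  assumes CR: "cross_ratio_bound \<kappa> W"
  shows "chi < 1"
proof -
  have "dobrushin (sinkS_even lam nu U V W n) \<le> 1 - \<kappa>" "dobrushin (sinkS_odd lam nu U V W n) \<le> 1 - \<kappa>" for n
    unfolding kernels(1,2)
    using odd.dobrushin_prev_le[OF cross_ratio_bound_transpose[OF CR], of n]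
      odd.dobrushin_cur_le[OF cross_ratio_bound_transpose[OF CR], of n] by auto
  then have "chi \<le> 1 - \<kappa>"
    unfolding chiS_def by (auto intro!: cSUP_least)
  moreover have "0 < \<kappa>" using CR by (simp add: cross_ratio_bound_def)
  ultimately show ?thesis by simp
qed

abbreviation "TV \<equiv> Phi_div (\<lambda>u v. ereal \<bar>u - v\<bar>)"

lemma TV_even_decay:
  "TV (gibbs nu V) (pe n) \<le> ereal (2 * chi ^ (2 * n))" "TV (pe n) (gibbs nu V) \<le> ereal (2 * chi ^ (2 * n))"
proof (induction n)
  case 0
  show "TV (gibbs nu V) (pe 0) \<le> ereal (2 * chi ^ (2 * 0))" "TV (pe 0) (gibbs nu V) \<le> ereal (2 * chi ^ (2 * 0))"
    using odd.Phi_div_tv_le_2[of 0, unfolded marginals] by simp_all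
next
  case (Suc n)
  note h = half_steps[OF entropy_function_tv, of n]
  have pow: "ereal (chi^2) * ereal (2 * chi ^ (2 * n)) = ereal (2 * chi ^ (2 * Suc n))"
    by (simp add: power_add power2_eq_square)
  have chi2: "(0::ereal) \<le> ereal (chi^2)" by simp
  have "TV (gibbs nu V) (pe (Suc n)) \<le> ereal (chi^2) * TV (gibbs nu V) (pe n)"
    using order_trans[OF h(4) chi_mult_mono[OF h(1)]] .
  also have "\<dots> \<le> ereal (chi^2) * ereal (2 * chi ^ (2 * n))"
    by (rule ereal_mult_left_mono[OF Suc(1) chi2])
  finally show "TV (gibbs nu V) (pe (Suc n)) \<le> ereal (2 * chi ^ (2 * Suc n))"
    unfolding pow .
  have "TV (pe (Suc n)) (gibbs nu V) \<le> ereal (chi^2) * TV (pe n) (gibbs nu V)"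
    using order_trans[OF h(3) chi_mult_mono[OF h(2)]] .
  also have "\<dots> \<le> ereal (chi^2) * ereal (2 * chi ^ (2 * n))"
    by (rule ereal_mult_left_mono[OF Suc(2) chi2])
  finally show "TV (pe (Suc n)) (gibbs nu V) \<le> ereal (2 * chi ^ (2 * Suc n))"
    unfolding pow .
qed

text \<open>The relative density of \<open>\<pi>\<^sub>2\<^sub>n\<^sub>+\<^sub>2\<close> is controlled by a distance of order \<open>\<chi>(S)\<^sup>2\<^sup>n\<^sup>+\<^sup>1\<close>, one power short of
the claim, which the constant makes up for. If \<open>\<chi>(S) = 0\<close>, both sides vanish.\<close>

lemma log_density_decay:
  assumes CR: "cross_ratio_bound \<kappa> W"
  shows "log_density_norm (gibbs lam U) (po n) \<le> ereal (2 / \<kappa>\<^sup>2 * chi ^ (2 * n))"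
    and "log_density_norm (gibbs nu V) (pe (Suc n)) \<le> ereal (2 / (\<kappa>\<^sup>2 * chi) * chi ^ (2 * Suc n))"
proof -
  have k: "0 \<le> ereal (1 / \<kappa>\<^sup>2)" by simp
  have "log_density_norm (gibbs lam U) (po n) \<le> ereal (1 / \<kappa>\<^sup>2) * TV (gibbs nu V) (pe n)"
    using odd.log_density_step[OF cross_ratio_bound_transpose[OF CR], of n] by (simp only: marginals)
  also have "\<dots> \<le> ereal (1 / \<kappa>\<^sup>2) * ereal (2 * chi ^ (2 * n))"
    by (rule ereal_mult_left_mono[OF TV_even_decay(1) k])
  finally show "log_density_norm (gibbs lam U) (po n) \<le> ereal (2 / \<kappa>\<^sup>2 * chi ^ (2 * n))"
    by simp
  have "log_density_norm (gibbs nu V) (pe (Suc n)) \<le> ereal (1 / \<kappa>\<^sup>2) * TV (gibbs lam U) (po n)"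
    using even.log_density_step[OF CR, of n] by (simp only: marginals)
  also have "\<dots> \<le> ereal (1 / \<kappa>\<^sup>2) * (ereal chi * ereal (2 * chi ^ (2 * n)))"
    using half_steps(2)[OF entropy_function_tv, of n] TV_even_decay(2)[of n] chi_nonneg
    by (intro ereal_mult_left_mono[OF _ k]) (meson ereal_less_eq(5) ereal_mult_left_mono order_trans)
  also have "\<dots> = ereal (2 / (\<kappa>\<^sup>2 * chi) * chi ^ (2 * Suc n))"
    by (cases "chi = 0") (simp_all add: field_simps power2_eq_square)
  finally show "log_density_norm (gibbs nu V) (pe (Suc n)) \<le> ereal (2 / (\<kappa>\<^sup>2 * chi) * chi ^ (2 * Suc n))" .
qed

end

theorem theorem4p1:
  fixes lam :: "'a::polish_space measure" and nu :: "'b::polish_space measure"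
    and U :: "'a \<Rightarrow> real" and V :: "'b \<Rightarrow> real" and W :: "'a \<Rightarrow> 'b \<Rightarrow> real"
  defines "lamU \<equiv> gibbs lam U"
    and "nuV \<equiv> gibbs nu V"
    and "pe \<equiv> sinkpi_even lam nu U V W"
    and "po \<equiv> sinkpi_odd lam nu U V W"
    and "chi \<equiv> chiS lam nu U V W"
  assumes "locally compact (UNIV :: 'a set)" and "locally compact (UNIV :: 'b set)"
    and "sets lam = sets borel" and "sets nu = sets borel"
    and "locally_bounded_measure lam" and "locally_bounded_measure nu"
    and "U \<in> borel_measurable borel" and "V \<in> borel_measurable borel"
    and "(\<lambda>(x, y). W x y) \<in> borel_measurable (borel \<Otimes>\<^sub>M borel)"
    and "prob_space lamU" and "prob_space nuV"
    and "kerQ nu W \<in> borel \<rightarrow>\<^sub>M prob_algebra borel"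
    and "\<exists>P. prob_space P \<and> sets P = sets (borel \<Otimes>\<^sub>M borel) \<and>
           distr P borel fst = lamU \<and> distr P borel snd = nuV \<and>
           finite_rel_entropy P
             (lamU \<bind> (\<lambda>x. kerQ nu W x \<bind> (\<lambda>y. return (borel \<Otimes>\<^sub>M borel) (x, y))))"
  shows "(\<forall>\<Phi>. entropy_function \<Phi> \<longrightarrow> (\<forall>n.
            (Phi_div \<Phi> (pe (n + 1)) nuV \<le> ereal chi * Phi_div \<Phi> lamU (po n) \<and>
             ereal chi * Phi_div \<Phi> lamU (po n) \<le> ereal (chi^2) * Phi_div \<Phi> (pe n) nuV) \<and>
            (Phi_div \<Phi> nuV (pe (n + 1)) \<le> ereal chi * Phi_div \<Phi> (po n) lamU \<and>
             ereal chi * Phi_div \<Phi> (po n) lamU \<le> ereal (chi^2) * Phi_div \<Phi> nuV (pe n)) \<and>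
            (Phi_div \<Phi> lamU (po (n + 1)) \<le> ereal chi * Phi_div \<Phi> (pe (n + 1)) nuV \<and>
             ereal chi * Phi_div \<Phi> (pe (n + 1)) nuV \<le> ereal (chi^2) * Phi_div \<Phi> lamU (po n)) \<and>
            (Phi_div \<Phi> (po (n + 1)) lamU \<le> ereal chi * Phi_div \<Phi> nuV (pe (n + 1)) \<and>
             ereal chi * Phi_div \<Phi> nuV (pe (n + 1)) \<le> ereal (chi^2) * Phi_div \<Phi> (po n) lamU)))
       \<and>
         (jQ W > 0 \<longrightarrow>
            chi < 1 \<and>
            (\<exists>c>0. \<forall>n.
               (n > 0 \<or> log_density_norm nuV (pe 0) < \<infinity> \<longrightarrow>
                  max (log_density_norm nuV (pe n)) (log_density_norm lamU (po n))
                    \<le> ereal (c * chi ^ (2 * n))) \<and>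
               log_density_norm lamU (po n) \<le> ereal (c * chi ^ (2 * n))))"
proof -
  note sets_lam = \<open>sets lam = sets borel\<close> and sets_nu = \<open>sets nu = sets borel\<close>
  have spaces: "space lam = UNIV" "space nu = UNIV"
    using sets_eq_imp_space_eq[OF sets_lam] sets_eq_imp_space_eq[OF sets_nu] by auto
  have Q_mass: "emeasure (gibbs nu (W x)) UNIV = 1" for x
  proof -
    have "kerQ nu W x \<in> space (prob_algebra borel)"
      using measurable_space[OF \<open>kerQ nu W \<in> borel \<rightarrow>\<^sub>M prob_algebra borel\<close>, of x] by simp
    then have "prob_space (gibbs nu (W x))" by (simp add: space_prob_algebra)
    then show ?thesis
      using prob_space.emeasure_space_1[of "gibbs nu (W x)"] by (simp add: gibbs_def spaces)
  qed
  interpret sinkhorn lam nu U V W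
  proof (intro sinkhorn.intro)
    show "U \<in> borel_measurable lam" "V \<in> borel_measurable nu"
      using \<open>U \<in> borel_measurable borel\<close> \<open>V \<in> borel_measurable borel\<close> sets_lam sets_nu
      by (simp_all cong: measurable_cong_sets)
    show "(\<lambda>(x, y). W x y) \<in> borel_measurable (lam \<Otimes>\<^sub>M nu)"
      using \<open>(\<lambda>(x, y). W x y) \<in> borel_measurable (borel \<Otimes>\<^sub>M borel)\<close> sets_lam sets_nu
      by (simp cong: measurable_cong_sets sets_pair_measure_cong)
    show "prob_space (gibbs lam U)" "prob_space (gibbs nu V)"
      using \<open>prob_space lamU\<close> \<open>prob_space nuV\<close> by (simp_all only: lamU_def nuV_def)
  qed (fact spaces Q_mass)+
  show ?thesis
    unfolding lamU_def nuV_def pe_def po_def chi_def Suc_eq_plus1[symmetric]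
  proof (intro conjI allI impI)
    fix \<Phi> n assume \<Phi>: "entropy_function \<Phi>"
    note h = half_steps[OF \<Phi>]
    show "Phi_div \<Phi> (sinkpi_even lam nu U V W (Suc n)) (gibbs nu V) \<le> ereal (chiS lam nu U V W) * Phi_div \<Phi> (gibbs lam U) (sinkpi_odd lam nu U V W n)"
      by (rule h)
    show "Phi_div \<Phi> (gibbs nu V) (sinkpi_even lam nu U V W (Suc n)) \<le> ereal (chiS lam nu U V W) * Phi_div \<Phi> (sinkpi_odd lam nu U V W n) (gibbs lam U)"
      by (rule h)
    show "Phi_div \<Phi> (gibbs lam U) (sinkpi_odd lam nu U V W (Suc n)) \<le> ereal (chiS lam nu U V W) * Phi_div \<Phi> (sinkpi_even lam nu U V W (Suc n)) (gibbs nu V)"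
      by (rule h)
    show "Phi_div \<Phi> (sinkpi_odd lam nu U V W (Suc n)) (gibbs lam U) \<le> ereal (chiS lam nu U V W) * Phi_div \<Phi> (gibbs nu V) (sinkpi_even lam nu U V W (Suc n))"
      by (rule h)
  next
    assume "0 < jQ W"
    note CR = jQ_cross_ratio[OF this]
    show "chiS lam nu U V W < 1" by (rule chi_lt_1[OF CR])
    (* the last term covers n = 0, where the hypothesis makes the norm finite *)
    define c where "c = max (max (2 / ((jQ W)\<^sup>2)\<^sup>2) (2 / (((jQ W)\<^sup>2)\<^sup>2 * chiS lam nu U V W)))
      (max 1 (real_of_ereal (log_density_norm (gibbs nu V) (sinkpi_even lam nu U V W 0))))"
    have le: "ereal (c' * chiS lam nu U V W ^ k) \<le> ereal (c * chiS lam nu U V W ^ k)" if "c' \<le> c" for c' k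
      using that chi_nonneg by (simp add: mult_right_mono)
    have odd_bound: "log_density_norm (gibbs lam U) (sinkpi_odd lam nu U V W n) \<le> ereal (c * chiS lam nu U V W ^ (2 * n))" for n
      by (rule order_trans[OF log_density_decay(1)[OF CR] le]) (simp add: c_def)
    have even_bound: "log_density_norm (gibbs nu V) (sinkpi_even lam nu U V W n) \<le> ereal (c * chiS lam nu U V W ^ (2 * n))"
      if n: "0 < n \<or> log_density_norm (gibbs nu V) (sinkpi_even lam nu U V W 0) < \<infinity>" for n
    proof (cases n)
      case 0
      have "log_density_norm (gibbs nu V) (sinkpi_even lam nu U V W 0)
          \<le> ereal (real_of_ereal (log_density_norm (gibbs nu V) (sinkpi_even lam nu U V W 0)))"
        using n 0 by (cases "log_density_norm (gibbs nu V) (sinkpi_even lam nu U V W 0)") auto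
      also have "\<dots> \<le> ereal c"
        unfolding ereal_less_eq c_def by (intro max.coboundedI2 order_refl)
      finally show ?thesis using 0 by simp
    next
      case (Suc m)
      show ?thesis
        unfolding Suc by (rule order_trans[OF log_density_decay(2)[OF CR] le]) (simp add: c_def)
    qed
    show "\<exists>c>0. \<forall>n.
        (n > 0 \<or> log_density_norm (gibbs nu V) (sinkpi_even lam nu U V W 0) < \<infinity> \<longrightarrow>
          max (log_density_norm (gibbs nu V) (sinkpi_even lam nu U V W n))
            (log_density_norm (gibbs lam U) (sinkpi_odd lam nu U V W n))
          \<le> ereal (c * chiS lam nu U V W ^ (2 * n))) \<and>
        log_density_norm (gibbs lam U) (sinkpi_odd lam nu U V W n) \<le> ereal (c * chiS lam nu U V W ^ (2 * n))"
    proof (intro exI[of _ c] conjI allI impI)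
      show "0 < c" by (simp add: c_def)
      fix n
      show "log_density_norm (gibbs lam U) (sinkpi_odd lam nu U V W n) \<le> ereal (c * chiS lam nu U V W ^ (2 * n))"
        by (rule odd_bound)
      assume "n > 0 \<or> log_density_norm (gibbs nu V) (sinkpi_even lam nu U V W 0) < \<infinity>"
      then show "max (log_density_norm (gibbs nu V) (sinkpi_even lam nu U V W n))
            (log_density_norm (gibbs lam U) (sinkpi_odd lam nu U V W n))
          \<le> ereal (c * chiS lam nu U V W ^ (2 * n))"
        using even_bound odd_bound by (intro max.boundedI)
    qed
  qed (rule chi_mult_mono; rule half_steps; assumption)+
qed

end
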